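(* Let $F$ satisfy the weak sequential closedness condition $$(q_n\rightharpoonup q \ \wedge \ F(q_n)\to g)\ \Rightarrow\ (q\in\mathcal D(F)\ \wedge\ F(q)=g)\qquad\text{for all } \{q_n\}_{n\in\mathbb N}\subseteq Q$$ and the tangential cone condition $$\|F(q)-F(\bar q)-F'(q)(q-\bar q)\|_G\le c_{tc}\|F(q)-F(\bar q)\|_G\qquad \forall q,\bar q\in \mathcal B_\rho(q_0)\subseteq\mathcal D(F)\subseteq Q$$ for some $\rho>0$, with $0<c_{tc}<\frac14$ sufficiently small. Let, further, $\tau>0$ be chosen sufficiently large and $0<\tilde{\underline\theta}<\tilde{\overline\theta}$ sufficiently small, such that $$2\Big(c_{tc}^2+\frac{(1+c_{tc})^2}{\tau^2}\Big)<\tilde{\underline\theta}\quad\text{and}\quad \frac{2\tilde{\overline\theta}+4c_{tc}^2}{1-4c_{tc}^2}<1 .$$ Let the discretization errors with respect to the quantities of interest satisfy $|I_{i,h}^k-I_i^k|\le\eta_i^k$, $i\in\{1,2,3,4\}$, where $\eta_1^k,\eta_2^k,\eta_3^k,\eta_4^k$ are selected such that $$\eta_1^k+2c_{tc}^2\eta_3^k\le\Big(\tilde{\underline\theta}-2\Big(c_{tc}^2+\frac{(1+c_{tc})^2}{\tau^2}\Big)\Big)I_{3,h}^k,$$ $$\eta_3^k\le c_1 I_{3,h}^k\quad\text{and}\quad \eta_2^k\to0,\ \eta_3^k\to0,\ \eta_4^k\to0\ \text{ as }k\to\infty,$$ $$I_{3,h}^k\le(1+c_3)I_{4,h}^{k-1}+r^k\quad\text{and}\quad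 (1+c_3)\frac{2\tilde{\overline\theta}+4c_{tc}^2}{1-4c_{tc}^2}\le c_2<1$$ for some constants $c_1,c_2,c_3>0$ and a sequence $r^k\to0$ as $k\to\infty$. Let $\beta_k$ and $h=h_k$ fulfil $\tilde{\underline\theta}\,I_{3,h}^k\le I_{2,h}^k\le\tilde{\overline\theta}\,I_{3,h}^k$, and let $k_*$ be selected according to $k_*=\min\{k\in\mathbb N: I_{3,h}^k\le\tau^2\delta^2\}$. Let additionally the source condition $$\exists s\in Q\ \text{ s.t. }\ q^\dagger-q_0=f(F'(q^\dagger)^*F'(q^\dagger))s$$ be fulfilled for some function $f:[0,\infty)\to[0,\infty)$ satisfying: $f(0)=0$; $f^2$ is strictly monotonically increasing; $\phi:=(f^2)^{-1}$ (i.e. $\phi^{-1}(\lambda)=f^2(\lambda)$) is convex; and $\Theta:\lambda\mapsto f(\lambda)\sqrt\lambda$ is strictly monotonically increasing. Then there exist a $\bar\delta>0$ and a constant $\bar C>0$ independent of $\delta$ such that for all $\delta\in(0,\bar\delta]$ $$\|q_h^{k_*}-q^\dagger\|_Q^2\le\frac{\bar C^2\delta^2}{\Theta^{-1}\big(\tfrac{\bar C}{2\|s\|_Q}\delta\big)}=4\|s\|^2\,f^2\Big(\Theta^{-1}\big(\tfrac{\bar C}{2\|s\|_Q}\delta\big)\Big),$$ where $\Theta(\lambda):=f(\lambda)\sqrt\lambda$.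
   Context: Setting. $Q,V,W,G$ are Hilbert spaces. The nonlinear operator is $F=C\circ S$, with domain $\mathcal D(F)\subseteq Q$ and values in $G$, where $C:V\to G$ is a measurement operator and $S:q\mapsto u\in V$ is the parameter-to-solution map of a (possibly nonlinear) PDE given in weak form with test space $W$; this PDE and its linearization are assumed uniquely and stably solvable. $F'(q)$ is the derivative of $F$ at $q$ and $F'(q)^*$ its Hilbert space adjoint; $f(F'(q^\dagger)^*F'(q^\dagger))$ is defined by functional calculus. $g\in G$ is the exact data and $g^\delta\in G$ the noisy data, with $\|g-g^\delta\|_G\le\delta$. $q^\dagger$ denotes a solution of $F(q)=g$, which is assumed to exist. $\mathcal B_\rho(q_0)$ is the ball of radius $\rho$ around the a priori guess $q_0\in Q$. Discretization. $Q_h,V_h,W_h$ are finite element spaces for $Q,V,W$; $S_h$ is the discrete solution operator of the PDE (solution in $V_h$, test functions in $W_h$), and $F_h=C\circ S_h$ with derivative $F_h'$. The norms in $Q$ and $G$ and the operator $C$ are evaluated exactly. The discretization may change from step to step; $h=h_k$ denotes the one in step $k$. Iteration (discretized iteratively regularized Gauss-Newton method). In step $k$, given $q_{\mathrm{old}}^k\in Q_{h_k}$ and a regularization parameter $\beta_k>0$, the discrete iterate $q_h^k=q^k_{h_k}$ is a minimizer over $q\in Q_{h_k}$ of $$\|F_{h_k}'(q_{\mathrm{old}}^k)(q-q_{\mathrm{old}}^k)+F_{h_k}(q_{\mathrm{old}}^k)-g^\delta\|_G^2+\tfrac1{\beta_k}\|q-q_0\|_Q^2,$$ the auxiliary continuous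 iterate $q^k$ is a minimizer over $q\in Q$ of $$\|F'(q_{\mathrm{old}}^k)(q-q_{\mathrm{old}}^k)+F(q_{\mathrm{old}}^k)-g^\delta\|_G^2+\tfrac1{\beta_k}\|q-q_0\|_Q^2,$$ and one sets $q_{\mathrm{old}}^{k+1}:=q_{h_k}^k$. The dependence of all iterates on $\delta$ and $g^\delta$ is suppressed in the notation. Quantities of interest. $I_1^k=\|F'(q_{\mathrm{old}}^k)(q^k-q_{\mathrm{old}}^k)+F(q_{\mathrm{old}}^k)-g^\delta\|_G^2+\frac1{\beta_k}\|q^k-q_0\|_Q^2$, $I_2^k=\|F'(q_{\mathrm{old}}^k)(q^k-q_{\mathrm{old}}^k)+F(q_{\mathrm{old}}^k)-g^\delta\|_G^2$, $I_3^k=\|F(q_{\mathrm{old}}^k)-g^\delta\|_G^2$, $I_4^k=\|F(q^k)-g^\delta\|_G^2$; $I_{1,h}^k=\|F_{h_k}'(q_{\mathrm{old}}^k)(q_{h_k}^k-q_{\mathrm{old}}^k)+F_{h_k}(q_{\mathrm{old}}^k)-g^\delta\|_G^2+\frac1{\beta_k}\|q_{h_k}^k-q_0\|_Q^2$, $I_{2,h}^k=\|F_{h_k}'(q_{\mathrm{old}}^k)(q_{h_k}^k-q_{\mathrm{old}}^k)+F_{h_k}(q_{\mathrm{old}}^k)-g^\delta\|_G^2$, $I_{3,h}^k=\|F_{h_k}(q_{\mathrm{old}}^k)-g^\delta\|_G^2$, $I_{4,h}^k=\|F_{h_k}(q_{h_k}^k)-g^\delta\|_G^2$.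
   Formalization: The bound is proved for the iterate that passed the stopping test, q_old^{k_*} (= q_h^{k_*-1} if k_*>0), as one further minimization can fit the noise; also assumed: q† lies in the open ball B_ρ(q_0), and the start satisfies ‖q_old^0−q_0‖ ≤ ‖q†−q_0‖ (e.g. q_old^0=q_0). *)

theory Defs
  imports "HOL-Analysis.Analysis" "HOL-Computational_Algebra.Polynomial"
begin

text \<open>Hilbert spaces are types of sort \<open>{real_inner, complete_space}\<close>.\<close>

definition weakly_converges :: "(nat \<Rightarrow> 'a::real_inner) \<Rightarrow> 'a \<Rightarrow> bool" where
  "weakly_converges X x \<longleftrightarrow> (\<forall>y. (\<lambda>n. X n \<bullet> y) \<longlonglongrightarrow> x \<bullet> y)"

text \<open>\<open>F\<close> is a partial map with domain \<open>D\<close>, so \<open>F (X n)\<close> presupposes \<open>X n \<in> D\<close>.\<close>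

definition weakly_seq_closed_at ::
    "'q::real_inner set \<Rightarrow> ('q \<Rightarrow> 'g::real_inner) \<Rightarrow> 'g \<Rightarrow> bool" where
  "weakly_seq_closed_at D F g \<longleftrightarrow>
     (\<forall>X x. (\<forall>n. X n \<in> D) \<and> weakly_converges X x \<and> (\<lambda>n. F (X n)) \<longlonglongrightarrow> g
        \<longrightarrow> x \<in> D \<and> F x = g)"

definition tangential_cone ::
    "'q::real_inner set \<Rightarrow> ('q \<Rightarrow> 'g::real_inner) \<Rightarrow> ('q \<Rightarrow> 'q \<Rightarrow>\<^sub>L 'g) \<Rightarrow> real \<Rightarrow> bool" where
  "tangential_cone B F F' c \<longleftrightarrow>
     (\<forall>q\<in>B. \<forall>p\<in>B. norm (F q - F p - F' q (q - p)) \<le> c * norm (F q - F p))"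


subsection \<open>Functional calculus\<close>

definition poly_op :: "real poly \<Rightarrow> ('a::real_vector \<Rightarrow> 'a) \<Rightarrow> 'a \<Rightarrow> 'a" where
  "poly_op p A x = (\<Sum>i\<le>degree p. coeff p i *\<^sub>R (A ^^ i) x)"

text \<open>
  The continuous functional calculus of a bounded self-adjoint operator \<open>A \<ge> 0\<close>, whose spectrum
  lies in \<open>[0, \<parallel>A\<parallel>]\<close>: \<open>f(A)\<close> is the operator-norm limit of \<open>p\<^sub>n(A)\<close> for polynomials
  \<open>p\<^sub>n\<close> converging uniformly to \<open>f\<close> on that interval. For the index functions below,
  continuity of \<open>f\<close> is automatic: \<open>f\<^sup>2\<close> is strictly increasing and its range, being the
  domain of a convex function, is an interval.
\<close>

definition fun_calc :: "(real \<Rightarrow> real) \<Rightarrow> ('a::real_normed_vector \<Rightarrow> 'a) \<Rightarrow> 'a \<Rightarrow> 'a" where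
  "fun_calc f A = (THE B. bounded_linear B \<and>
     (\<forall>p. uniform_limit {0..onorm A} (\<lambda>n. poly (p n)) f sequentially
        \<longrightarrow> (\<lambda>n. onorm (\<lambda>x. poly_op (p n) A x - B x)) \<longlonglongrightarrow> 0))"

definition Theta :: "(real \<Rightarrow> real) \<Rightarrow> real \<Rightarrow> real" where
  "Theta f l = f l * sqrt l"

definition Theta_inv :: "(real \<Rightarrow> real) \<Rightarrow> real \<Rightarrow> real" where
  "Theta_inv f = the_inv_into {0..} (Theta f)"

definition index_function :: "(real \<Rightarrow> real) \<Rightarrow> bool" where
  "index_function f \<longleftrightarrow>
     (\<forall>l\<ge>0. f l \<ge> 0) \<and> f 0 = 0 \<and>
     strict_mono_on {0..} (\<lambda>l. (f l)\<^sup>2) \<and>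
     convex_on ((\<lambda>l. (f l)\<^sup>2) ` {0..}) (the_inv_into {0..} (\<lambda>l. (f l)\<^sup>2)) \<and>
     strict_mono_on {0..} (Theta f)"


subsection \<open>The PDE and its discretization\<close>

text \<open>
  \<open>E q u\<close> is the residual of the weak formulation, a bounded linear functional of the test
  function; \<open>u\<close> solves the PDE for the parameter \<open>q\<close> iff \<open>E q u w = 0\<close> for all test functions
  \<open>w\<close>. Unique solvability says that \<open>S q\<close> is the only solution, stability that it depends
  continuously on \<open>q\<close>.
\<close>

definition pde_solution_map ::
    "'q::real_inner set \<Rightarrow> ('q \<Rightarrow> 'v::real_inner \<Rightarrow> ('w::real_inner \<Rightarrow>\<^sub>L real)) \<Rightarrow>
     ('q \<Rightarrow> 'v) \<Rightarrow> bool" where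
  "pde_solution_map D E S \<longleftrightarrow>
     (\<forall>q\<in>D. \<forall>u. (\<forall>w. E q u w = 0) \<longleftrightarrow> u = S q) \<and> continuous_on D S"

text \<open>
  The linearized equation \<open>E\<^sub>u(q, S q) v = R\<close> has, for every right-hand side \<open>R\<close> in the dual of
  the test space, exactly one solution \<open>v\<close>, and \<open>v\<close> is bounded in terms of \<open>R\<close>.
\<close>

definition linearized_pde_well_posed ::
    "'q::real_inner set \<Rightarrow> ('q \<Rightarrow> 'v::real_inner \<Rightarrow> ('w::real_inner \<Rightarrow>\<^sub>L real)) \<Rightarrow>
     ('q \<Rightarrow> 'v) \<Rightarrow> bool" where
  "linearized_pde_well_posed B E S \<longleftrightarrow>
     (\<forall>q\<in>B. \<exists>(Eq :: 'q \<Rightarrow>\<^sub>L ('w \<Rightarrow>\<^sub>L real)) (Eu :: 'v \<Rightarrow>\<^sub>L ('w \<Rightarrow>\<^sub>L real)).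
        ((\<lambda>(p, u). E p u) has_derivative (\<lambda>(p, v). Eq p + Eu v)) (at (q, S q)) \<and>
        (\<forall>R. \<exists>!v. Eu v = R) \<and>
        (\<exists>M. \<forall>v. norm v \<le> M * norm (Eu v)))"

definition finite_dim_subspace :: "'a::real_vector set \<Rightarrow> bool" where
  "finite_dim_subspace X \<longleftrightarrow> (\<exists>B. finite B \<and> X = span B)"

text \<open>\<open>'h\<close> indexes the available discretizations.\<close>

definition galerkin_discretization ::
    "'q::real_inner set \<Rightarrow> ('q \<Rightarrow> 'v::real_inner \<Rightarrow> ('w::real_inner \<Rightarrow>\<^sub>L real)) \<Rightarrow>
     ('h \<Rightarrow> 'q set) \<Rightarrow> ('h \<Rightarrow> 'v set) \<Rightarrow> ('h \<Rightarrow> 'w set) \<Rightarrow> ('h \<Rightarrow> 'q \<Rightarrow> 'v) \<Rightarrow> bool" where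
  "galerkin_discretization D E Qh Vh Wh Sh \<longleftrightarrow>
     (\<forall>h. finite_dim_subspace (Qh h) \<and> finite_dim_subspace (Vh h) \<and> finite_dim_subspace (Wh h) \<and>
        (\<forall>q\<in>Qh h \<inter> D. \<forall>u. (u \<in> Vh h \<and> (\<forall>w\<in>Wh h. E q u w = 0)) \<longleftrightarrow> u = Sh h q))"


subsection \<open>The iteration\<close>

definition lin_residual ::
    "('q::real_inner \<Rightarrow> 'g::real_inner) \<Rightarrow> ('q \<Rightarrow> 'q \<Rightarrow>\<^sub>L 'g) \<Rightarrow> 'g \<Rightarrow> 'q \<Rightarrow> 'q \<Rightarrow> real" where
  "lin_residual F F' y p q = (norm (F' p (q - p) + F p - y))\<^sup>2"

definition gn_functional ::
    "('q::real_inner \<Rightarrow> 'g::real_inner) \<Rightarrow> ('q \<Rightarrow> 'q \<Rightarrow>\<^sub>L 'g) \<Rightarrow> 'q \<Rightarrow> 'g \<Rightarrow> real \<Rightarrow>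
     'q \<Rightarrow> 'q \<Rightarrow> real" where
  "gn_functional F F' q0 y b p q = lin_residual F F' y p q + 1 / b * (norm (q - q0))\<^sup>2"

text \<open>
  One run of the method: noisy data \<open>g\<^sup>\<delta>\<close> and, for each step \<open>k\<close>, the discretization \<open>h\<^sub>k\<close>, the
  parameter \<open>\<beta>\<^sub>k\<close>, and \<open>q\<^sup>k\<^sub>o\<^sub>l\<^sub>d\<close>, \<open>q\<^sup>k\<close> (auxiliary continuous iterate), \<open>q\<^sup>k\<^sub>h\<close> (discrete iterate).
\<close>

record ('q, 'g, 'h) run =
  gdata :: 'g
  mesh :: "nat \<Rightarrow> 'h"
  beta :: "nat \<Rightarrow> real"
  q_old :: "nat \<Rightarrow> 'q"
  q_cont :: "nat \<Rightarrow> 'q"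
  q_disc :: "nat \<Rightarrow> 'q"

definition I1 :: "('q::real_inner \<Rightarrow> 'g::real_inner) \<Rightarrow> ('q \<Rightarrow> 'q \<Rightarrow>\<^sub>L 'g) \<Rightarrow> 'q \<Rightarrow>
    ('q, 'g, 'h) run \<Rightarrow> nat \<Rightarrow> real" where
  "I1 F F' q0 R k = gn_functional F F' q0 (gdata R) (beta R k) (q_old R k) (q_cont R k)"

definition I2 :: "('q::real_inner \<Rightarrow> 'g::real_inner) \<Rightarrow> ('q \<Rightarrow> 'q \<Rightarrow>\<^sub>L 'g) \<Rightarrow>
    ('q, 'g, 'h) run \<Rightarrow> nat \<Rightarrow> real" where
  "I2 F F' R k = lin_residual F F' (gdata R) (q_old R k) (q_cont R k)"

definition I3 :: "('q::real_inner \<Rightarrow> 'g::real_inner) \<Rightarrow> ('q, 'g, 'h) run \<Rightarrow> nat \<Rightarrow> real" where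
  "I3 F R k = (norm (F (q_old R k) - gdata R))\<^sup>2"

definition I4 :: "('q::real_inner \<Rightarrow> 'g::real_inner) \<Rightarrow> ('q, 'g, 'h) run \<Rightarrow> nat \<Rightarrow> real" where
  "I4 F R k = (norm (F (q_cont R k) - gdata R))\<^sup>2"

definition I1h :: "('h \<Rightarrow> 'q::real_inner \<Rightarrow> 'g::real_inner) \<Rightarrow> ('h \<Rightarrow> 'q \<Rightarrow> 'q \<Rightarrow>\<^sub>L 'g) \<Rightarrow> 'q \<Rightarrow>
    ('q, 'g, 'h) run \<Rightarrow> nat \<Rightarrow> real" where
  "I1h Fh Fh' q0 R k =
     gn_functional (Fh (mesh R k)) (Fh' (mesh R k)) q0 (gdata R) (beta R k) (q_old R k) (q_disc R k)"

definition I2h :: "('h \<Rightarrow> 'q::real_inner \<Rightarrow> 'g::real_inner) \<Rightarrow> ('h \<Rightarrow> 'q \<Rightarrow> 'q \<Rightarrow>\<^sub>L 'g) \<Rightarrow>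
    ('q, 'g, 'h) run \<Rightarrow> nat \<Rightarrow> real" where
  "I2h Fh Fh' R k =
     lin_residual (Fh (mesh R k)) (Fh' (mesh R k)) (gdata R) (q_old R k) (q_disc R k)"

definition I3h :: "('h \<Rightarrow> 'q::real_inner \<Rightarrow> 'g::real_inner) \<Rightarrow>
    ('q, 'g, 'h) run \<Rightarrow> nat \<Rightarrow> real" where
  "I3h Fh R k = (norm (Fh (mesh R k) (q_old R k) - gdata R))\<^sup>2"

definition I4h :: "('h \<Rightarrow> 'q::real_inner \<Rightarrow> 'g::real_inner) \<Rightarrow>
    ('q, 'g, 'h) run \<Rightarrow> nat \<Rightarrow> real" where
  "I4h Fh R k = (norm (Fh (mesh R k) (q_disc R k) - gdata R))\<^sup>2"

definition stopping_index ::
    "('h \<Rightarrow> 'q::real_inner \<Rightarrow> 'g::real_inner) \<Rightarrow> ('q, 'g, 'h) run \<Rightarrow> real \<Rightarrow> real \<Rightarrow> nat \<Rightarrow> bool" where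
  "stopping_index Fh R \<tau> \<delta> ks \<longleftrightarrow>
     I3h Fh R ks \<le> \<tau>\<^sup>2 * \<delta>\<^sup>2 \<and> (\<forall>k<ks. \<not> I3h Fh R k \<le> \<tau>\<^sup>2 * \<delta>\<^sup>2)"

text \<open>
  The iteration terminated at step \<open>ks\<close>. The stopping test of step \<open>k\<close> examines \<open>q_old k\<close>, before
  a minimization is carried out; hence the minimizations are those of the steps \<open>k < ks\<close>, and the
  approximation returned in step \<open>ks\<close> is the one that passed the test, \<open>q_old ks\<close> (which is
  \<open>q_disc (ks - 1)\<close> if \<open>ks > 0\<close>). A further minimization would not do: it may push the residual
  below the noise level, and its result is then not controlled by \<open>\<delta>\<close>. The initial guess has to be
  at most as far from \<open>q0\<close> as the solution \<open>qd\<close>; this includes \<open>q_old 0 = q0\<close>.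
\<close>

definition irgnm_run ::
    "('q::real_inner \<Rightarrow> 'g::real_inner) \<Rightarrow> ('q \<Rightarrow> 'q \<Rightarrow>\<^sub>L 'g) \<Rightarrow>
     ('h \<Rightarrow> 'q set) \<Rightarrow> ('h \<Rightarrow> 'q \<Rightarrow> 'g) \<Rightarrow> ('h \<Rightarrow> 'q \<Rightarrow> 'q \<Rightarrow>\<^sub>L 'g) \<Rightarrow> 'q \<Rightarrow> 'q \<Rightarrow>
     ('q, 'g, 'h) run \<Rightarrow> nat \<Rightarrow> bool" where
  "irgnm_run F F' Qh Fh Fh' q0 qd R ks \<longleftrightarrow>
     norm (q_old R 0 - q0) \<le> norm (qd - q0) \<and>
     (\<forall>k\<le>ks. q_old R k \<in> Qh (mesh R k)) \<and>
     (\<forall>k<ks. beta R k > 0 \<and>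
        is_arg_min (gn_functional (Fh (mesh R k)) (Fh' (mesh R k)) q0 (gdata R) (beta R k) (q_old R k))
          (\<lambda>q. q \<in> Qh (mesh R k)) (q_disc R k) \<and>
        is_arg_min (gn_functional F F' q0 (gdata R) (beta R k) (q_old R k))
          (\<lambda>q. True) (q_cont R k) \<and>
        q_old R (Suc k) = q_disc R k) \<and>
     q_disc R ks = q_old R ks"

end

theory Submission
  imports Defs
begin

text \<open>
  Let \<open>T = F'(qd)\<close> and \<open>A = T\<^sup>* T\<close>. Before the stopping index the noise level is dominated by the
  residual, so minimality of \<open>q_cont\<close>, tested with \<open>qd\<close>, gives \<open>\<parallel>q - q0\<parallel> \<le> \<parallel>qd - q0\<parallel>\<close> for every
  iterate \<open>q\<close>. With \<open>e = q - qd\<close> this reads \<open>\<parallel>e\<parallel>\<^sup>2 \<le> -2 \<langle>e, f(A) s\<rangle> \<le> 2 \<parallel>f(A) e\<parallel> \<parallel>s\<parallel>\<close>. As \<open>f\<^sup>2\<close> is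
  concave, \<open>\<parallel>T e\<parallel>\<^sup>2 \<le> \<mu> \<parallel>e\<parallel>\<^sup>2\<close> implies \<open>\<parallel>f(A) e\<parallel> \<le> f(\<mu>) \<parallel>e\<parallel>\<close> (Jensen's inequality). At the stopping
  index the cone condition gives \<open>\<parallel>T e\<parallel> \<le> K \<delta>\<close>; choosing \<open>\<mu> = \<Theta>\<^sup>-\<^sup>1(K \<delta> / (2 \<parallel>s\<parallel>))\<close> yields the rate.
  Spectral measures are avoided: Jensen's inequality is the inequality \<open>f\<^sup>2 \<le> l\<close> for a supporting line \<open>l\<close>,
  transferred to \<open>A\<close> through polynomials \<open>p \<ge> 0\<close> on \<open>[0, \<parallel>A\<parallel>]\<close>, for which \<open>p(A) \<ge> 0\<close>.
\<close>

section \<open>Adjoints in Hilbert spaces\<close>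

text \<open>The representer is the minimizer of the quadratic energy \<open>J\<close>:
  \<open>J\<close> is bounded below, a minimizing sequence is Cauchy by completeness of the square,
  and the first variation at its limit vanishes.\<close>

lemma Riesz_representation:
  fixes l :: "'a::{real_inner,complete_space} \<Rightarrow> real"
  assumes "bounded_linear l"
  obtains z where "\<And>x. l x = x \<bullet> z"
proof -
  interpret l: bounded_linear l by fact
  define J where "J x = (norm x)\<^sup>2 - 2 * l x" for x
  define m where "m = Inf (range J)"
  obtain K where K: "\<And>x. norm (l x) \<le> norm x * K"
    using l.bounded by blast
  have "J x \<ge> - K\<^sup>2" for x
  proof -
    have "l x \<le> norm x * K" using K[of x] by simp
    moreover have "0 \<le> (norm x - K)\<^sup>2" by simp
    ultimately show ?thesis
      unfolding J_def by (simp add: power2_diff algebra_simps)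
  qed
  then have bdd: "bdd_below (range J)" by (auto intro!: bdd_belowI)
  have m_le: "m \<le> J x" for x
    unfolding m_def by (rule cInf_lower[OF _ bdd]) simp
  have "\<exists>x. J x < m + inverse (real (Suc n))" for n
  proof -
    have "Inf (range J) < m + inverse (real (Suc n))" by (simp add: m_def)
    then show ?thesis using cInf_less_iff[OF _ bdd] by auto
  qed
  then obtain X where X: "\<And>n. J (X n) < m + inverse (real (Suc n))" by metis
  \<comment> \<open>Parallelogram identity: the linear parts of \<open>J\<close> cancel, and the
    midpoint costs at least \<open>m\<close>.\<close>
  have dist_le: "(norm (x - y))\<^sup>2 \<le> 2 * (J x - m) + 2 * (J y - m)" for x y
  proof -
    have "(norm (x - y))\<^sup>2 = 2 * J x + 2 * J y - 4 * J ((1/2) *\<^sub>R (x + y))"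
      unfolding J_def l.scaleR l.add power2_norm_eq_inner
      by (simp add: inner_add inner_diff inner_commute algebra_simps)
    then show ?thesis using m_le[of "(1/2) *\<^sub>R (x + y)"] by simp
  qed
  have "Cauchy X"
  proof (rule metric_CauchyI)
    fix e :: real assume e: "e > 0"
    then obtain N where N: "inverse (real (Suc N)) < e\<^sup>2 / 4"
      using reals_Archimedean[of "e\<^sup>2/4"] by auto
    have "dist (X i) (X j) < e" if "i \<ge> N" "j \<ge> N" for i j
    proof -
      have "inverse (real (Suc i)) \<le> inverse (real (Suc N))"
           "inverse (real (Suc j)) \<le> inverse (real (Suc N))"
        using that by (auto intro!: le_imp_inverse_le)
      then have "(norm (X i - X j))\<^sup>2 < e\<^sup>2"
        using dist_le[of "X i" "X j"] X[of i] X[of j] N by argo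
      then show ?thesis using e power2_less_imp_less[of "norm (X i - X j)" e]
        by (simp add: dist_norm)
    qed
    then show "\<exists>N. \<forall>i\<ge>N. \<forall>j\<ge>N. dist (X i) (X j) < e" by blast
  qed
  then obtain z where z: "X \<longlonglongrightarrow> z"
    using Cauchy_convergent convergent_def by blast
  have "(\<lambda>n. J (X n)) \<longlonglongrightarrow> J z"
    unfolding J_def by (intro tendsto_intros l.tendsto z)
  moreover have "(\<lambda>n. m + inverse (real (Suc n))) \<longlonglongrightarrow> m"
    using tendsto_add[OF tendsto_const LIMSEQ_inverse_real_of_nat, of m] by simp
  ultimately have Jz: "J z \<le> m"
    by (rule LIMSEQ_le) (use X less_imp_le in blast)
  have "l y = y \<bullet> z" for y
  proof -
    define a where "a = (norm y)\<^sup>2"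
    define b where "b = y \<bullet> z - l y"
    have a: "a \<ge> 0" by (simp add: a_def)
    \<comment> \<open>The minimizer along \<open>y\<close> would be \<open>- b / a\<close>; the
      added 1 covers \<open>y = 0\<close> and still lowers \<open>J\<close> unless
      \<open>b = 0\<close>.\<close>
    define t where "t = - b / (a + 1)"
    have "J (z + t *\<^sub>R y) = J z + t\<^sup>2 * a + 2 * t * b"
      unfolding J_def a_def b_def l.scaleR l.add power2_norm_eq_inner
      by (simp add: inner_add inner_commute algebra_simps power2_eq_square)
    then have "0 \<le> t\<^sup>2 * a + 2 * t * b"
      using Jz m_le[of "z + t *\<^sub>R y"] by simp
    also have "\<dots> = - (b\<^sup>2 * (a + 2)) / (a + 1)\<^sup>2"
      using a unfolding t_def by (simp add: divide_simps power2_eq_square) algebra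
    finally have "b\<^sup>2 * (a + 2) \<le> 0"
      using a by (simp add: divide_simps)
    then have "b = 0"
      using a by (smt (verit) mult_pos_pos zero_less_power2)
    then show ?thesis by (simp add: b_def)
  qed
  then show thesis by (rule that)
qed

text \<open>\<open>adjoint\<close> is a choice term, so its characteristic property is available
  only once the Riesz representation has supplied some adjoint.\<close>

lemma inner_adjoint:
  fixes T :: "'a::{real_inner,complete_space} \<Rightarrow> 'b::real_inner"
  assumes "bounded_linear T"
  shows "T x \<bullet> y = x \<bullet> adjoint T y"
proof -
  have "\<exists>z. \<forall>x. T x \<bullet> y = x \<bullet> z" for y
    using Riesz_representation[OF bounded_linear_inner_left_comp[OF assms, of y]] by metis
  then have "\<exists>T'. \<forall>x y. T x \<bullet> y = x \<bullet> T' y"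
    by metis
  then show ?thesis
    unfolding adjoint_def by (rule someI2_ex) blast
qed

section \<open>Polynomials of positive operators\<close>

lemma poly_op_0 [simp]: "poly_op 0 A x = 0"
  by (simp add: poly_op_def)

text \<open>Horner's recursion, which opens \<open>poly_op\<close> to induction over the
  coefficients. The zero polynomial is treated apart because \<open>pCons a 0\<close> does not raise
  the degree.\<close>

lemma poly_op_pCons:
  assumes "linear A"
  shows "poly_op (pCons a p) A x = a *\<^sub>R x + A (poly_op p A x)"
proof (cases "p = 0")
  case True
  then show ?thesis by (simp add: poly_op_def linear_0[OF assms])
next
  case False
  interpret A: linear A by fact
  show ?thesis
    using False unfolding poly_op_def
    by (simp add: sum.atMost_Suc_shift A.sum A.scaleR del: sum.atMost_Suc)
qed

lemma linear_poly_op: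
  assumes "linear A"
  shows "linear (poly_op p A)"
proof -
  interpret A: linear A by fact
  show ?thesis
  proof (induction p)
    case 0
    then show ?case by (auto intro!: linearI)
  next
    case (pCons a p)
    interpret P: linear "poly_op p A" by fact
    show ?case
      by (auto intro!: linearI simp: poly_op_pCons[OF assms] A.add A.scaleR P.add P.scaleR algebra_simps)
  qed
qed

lemma poly_op_add:
  assumes "linear A"
  shows "poly_op (p + q) A x = poly_op p A x + poly_op q A x"
proof -
  interpret A: linear A by fact
  show ?thesis
    by (induction p q rule: poly_induct2)
      (simp_all add: poly_op_pCons[OF assms] A.add algebra_simps)
qed

lemma poly_op_smult:
  assumes "linear A"
  shows "poly_op (smult c p) A x = c *\<^sub>R poly_op p A x"
proof -
  interpret A: linear A by fact
  show ?thesis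
    by (induction p) (simp_all add: poly_op_pCons[OF assms] A.scaleR algebra_simps)
qed

lemma poly_op_diff:
  assumes "linear A"
  shows "poly_op (p - q) A x = poly_op p A x - poly_op q A x"
  using poly_op_add[OF assms, of p "smult (-1) q" x] poly_op_smult[OF assms, of "-1" q x] by simp

lemma poly_op_mult:
  assumes "linear A"
  shows "poly_op (p * q) A x = poly_op p A (poly_op q A x)"
proof -
  interpret A: linear A by fact
  show ?thesis
    by (induction p)
      (simp_all add: poly_op_pCons[OF assms] poly_op_add[OF assms] poly_op_smult[OF assms])
qed

lemma bounded_linear_poly_op:
  assumes "bounded_linear A"
  shows "bounded_linear (poly_op p A)"
proof (induction p)
  case 0
  then show ?case by (simp add: poly_op_def)
next
  case (pCons a p)
  have "bounded_linear (\<lambda>x. a *\<^sub>R x + A (poly_op p A x))"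
    by (intro bounded_linear_add bounded_linear_scaleR_right
        bounded_linear_compose[OF assms pCons.IH])
  then show ?case
    using poly_op_pCons[OF bounded_linear.linear[OF assms], of a p] by (simp add: fun_eq_iff)
qed

section \<open>Operators of polynomials that are nonnegative on the spectral interval\<close>

locale positive_operator =
  fixes A :: "'a::{real_inner,complete_space} \<Rightarrow> 'a"
  assumes bounded_linear: "bounded_linear A"
    and self_adjoint: "A x \<bullet> y = x \<bullet> A y"
    and positive: "0 \<le> x \<bullet> A x"
begin

sublocale A: bounded_linear A by (rule bounded_linear)

lemma lin: "linear A" by (rule A.linear)

lemmas poly_op_simps =
  poly_op_pCons[OF lin] poly_op_add[OF lin] poly_op_diff[OF lin]
  poly_op_smult[OF lin] poly_op_mult[OF lin]

lemma poly_op_self_adjoint: "poly_op p A x \<bullet> y = x \<bullet> poly_op p A y"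
proof (induction p arbitrary: x y)
  case (pCons a p)
  \<comment> \<open>Commutativity of the polynomial ring, carried over to operators by
    \<open>poly_op_mult\<close>.\<close>
  have "A (poly_op p A y) = poly_op p A (A y)" for y
    using poly_op_mult[OF lin, of p "[:0, 1:]" y] poly_op_mult[OF lin, of "[:0, 1:]" p y]
    by (simp only: mult.commute) (simp add: poly_op_simps)
  then show ?case
    by (simp add: poly_op_simps inner_add self_adjoint pCons.IH)
qed simp

definition pos :: "real poly \<Rightarrow> bool" where
  "pos p \<longleftrightarrow> (\<forall>x. 0 \<le> x \<bullet> poly_op p A x)"

lemma pos_add: "pos p \<Longrightarrow> pos q \<Longrightarrow> pos (p + q)"
  by (auto simp: pos_def poly_op_simps inner_add)

lemma pos_smult: "0 \<le> c \<Longrightarrow> pos p \<Longrightarrow> pos (smult c p)"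
  by (auto simp: pos_def poly_op_simps)

text \<open>Self-adjointness moves one factor \<open>q(A)\<close> across the inner product, which
  leaves the quadratic form of \<open>p(A)\<close> at \<open>q(A) x\<close>.\<close>

lemma pos_square_mult: "pos p \<Longrightarrow> pos (q * q * p)"
proof -
  assume p: "pos p"
  have "x \<bullet> poly_op (q * (p * q)) A x = poly_op q A x \<bullet> poly_op p A (poly_op q A x)" for x
    by (simp only: poly_op_mult[OF lin] poly_op_self_adjoint)
  then have "pos (q * (p * q))" using p by (simp add: pos_def)
  then show ?thesis by (simp add: mult_ac)
qed

text \<open>
  Positivity of \<open>p(A)\<close> alone is not known to be preserved by products with \<open>X\<close> or \<open>M - X\<close>, as this
  would need square roots of operators. The four conditions together are preserved: up to squares,
  these products only permute them.
\<close>

definition cone :: "real \<Rightarrow> real poly \<Rightarrow> bool" where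
  "cone M p \<longleftrightarrow> pos p \<and> pos ([:0, 1:] * p) \<and> pos ([:M, -1:] * p) \<and> pos ([:0, 1:] * [:M, -1:] * p)"

lemma cone_add: "cone M p \<Longrightarrow> cone M q \<Longrightarrow> cone M (p + q)"
  unfolding cone_def distrib_left by (blast intro: pos_add)

lemma cone_smult: "0 \<le> c \<Longrightarrow> cone M p \<Longrightarrow> cone M (smult c p)"
  unfolding cone_def mult_smult_right by (blast intro: pos_smult)

lemma cone_square_mult: "cone M p \<Longrightarrow> cone M (q * q * p)"
  unfolding cone_def
  using pos_square_mult[of p q] pos_square_mult[of "[:0, 1:] * p" q]
    pos_square_mult[of "[:M, -1:] * p" q] pos_square_mult[of "[:0, 1:] * [:M, -1:] * p" q]
  by (simp only: mult_ac)

lemma cone_X_mult: "cone M p \<Longrightarrow> cone M ([:0, 1:] * p)"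
  unfolding cone_def
  using pos_square_mult[of p "[:0, 1:]"] pos_square_mult[of "[:M, -1:] * p" "[:0, 1:]"]
  by (simp only: mult_ac)

lemma cone_M_minus_X_mult: "cone M p \<Longrightarrow> cone M ([:M, -1:] * p)"
  unfolding cone_def
  using pos_square_mult[of p "[:M, -1:]"] pos_square_mult[of "[:0, 1:] * p" "[:M, -1:]"]
  by (simp only: mult_ac)

lemma cone_1:
  assumes "M > 0" and bound: "\<And>x. norm (A x) \<le> M * norm x"
  shows "cone M 1"
proof -
  have one: "pos 1"
    by (simp add: pos_def one_pCons poly_op_simps)
  have X: "pos [:0, 1:]"
    by (simp add: pos_def poly_op_simps positive)
  have Y: "pos [:M, -1:]"
  proof -
    have "x \<bullet> A x \<le> M * (x \<bullet> x)" for x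
    proof -
      have "x \<bullet> A x \<le> norm x * norm (A x)" by (rule norm_cauchy_schwarz)
      also have "\<dots> \<le> norm x * (M * norm x)" by (intro mult_left_mono bound) simp
      finally show ?thesis by (simp add: dot_square_norm power2_eq_square mult_ac)
    qed
    then show ?thesis
      by (simp add: pos_def poly_op_simps A.neg inner_diff)
  qed
  \<comment> \<open>Dividing \<open>X\<^sup>2 (M - X) + (M - X)\<^sup>2 X\<close> by
    \<open>M\<close> writes \<open>X (M - X)\<close> through squares times polynomials already known
    to be positive.\<close>
  have "[:0, 1:] * [:M, -1:] = smult (inverse M)
     ([:0, 1:] * [:0, 1:] * [:M, -1:] + [:M, -1:] * [:M, -1:] * [:0, 1:])"
    using \<open>M > 0\<close> by (simp add: field_simps)
  then have "pos ([:0, 1:] * [:M, -1:])"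
    using pos_square_mult[OF Y, of "[:0, 1:]"] pos_square_mult[OF X, of "[:M, -1:]"] \<open>M > 0\<close>
    by (metis pos_add pos_smult inverse_nonnegative_iff_nonnegative less_imp_le)
  then show ?thesis
    using one X Y by (simp add: cone_def)
qed

text \<open>
  Induction on the degree: subtracting the minimum of \<open>p\<close> on \<open>[0, M]\<close>, attained at \<open>a\<close>, leaves a
  polynomial divisible by \<open>X\<close>, \<open>M - X\<close> or \<open>(X - a)\<^sup>2\<close> with a quotient that is nonnegative again.
\<close>

lemma cone_nonneg:
  assumes "M > 0" and bound: "\<And>x. norm (A x) \<le> M * norm x"
    and "\<And>t. t \<in> {0..M} \<Longrightarrow> 0 \<le> poly p t"
  shows "cone M p"
  using assms(3)
proof (induction "degree p" arbitrary: p rule: less_induct)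
  case less
  have const: "cone M [:c:]" if "c \<ge> 0" for c
    using cone_smult[OF that cone_1[OF assms(1,2)]] by (simp add: one_pCons)
  show ?case
  proof (cases "degree p = 0")
    case True
    then obtain c where "p = [:c:]" by (rule degree_eq_zeroE)
    then show ?thesis using less.prems[of 0] const \<open>M > 0\<close> by simp
  next
    case False
    obtain a where a: "a \<in> {0..M}" and min: "\<And>t. t \<in> {0..M} \<Longrightarrow> poly p a \<le> poly p t"
    proof -
      have "continuous_on {0..M} (poly p)" by (intro continuous_intros)
      then show thesis
        using continuous_attains_inf[of "{0..M}" "poly p"] \<open>M > 0\<close> that by auto
    qed
    define c where "c = poly p a"
    have c: "c \<ge> 0" using less.prems a by (simp add: c_def)
    have "poly (p - [:c:]) a = 0" by (simp add: c_def)
    then obtain q where q: "p - [:c:] = [:- a, 1:] * q"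
      by (metis poly_eq_0_iff_dvd dvdE)
    have p: "p = [:- a, 1:] * q + [:c:]" using q by (simp add: algebra_simps)
    have q0: "q \<noteq> 0" using p False by auto
    have deg: "degree p = Suc (degree q)"
    proof -
      have "degree ([:- a, 1:] * q) = Suc (degree q)"
        using q0 by (subst degree_mult_eq) auto
      then show ?thesis unfolding p by (subst degree_add_eq_left) auto
    qed
    have sgn: "0 \<le> (t - a) * poly q t" if "t \<in> {0..M}" for t
    proof -
      have "poly p t = (t - a) * poly q t + c" by (subst p) (simp add: algebra_simps)
      then show ?thesis using min[OF that] by (simp add: c_def)
    qed
    have lim: "((\<lambda>t. poly q t) \<longlongrightarrow> poly q a) (at a within S)" for S
      by (intro tendsto_intros)
    \<comment> \<open>\<open>sgn\<close> is silent at \<open>a\<close> itself, so the sign of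
      \<open>q\<close> there is a one-sided limit. At an interior minimum both signs hold, which
      produces the double root.\<close>
    have right: "0 \<le> poly q a" if "a < M"
    proof (rule tendsto_lowerbound[OF lim])
      show "\<forall>\<^sub>F t in at a within {a<..}. 0 \<le> poly q t"
        using eventually_at_right_less[of a] eventually_at_right_real[OF that]
      proof eventually_elim
        case (elim t)
        then show ?case using sgn[of t] a by (simp add: zero_le_mult_iff)
      qed
    qed simp
    have left: "poly q a \<le> 0" if "0 < a"
    proof (rule tendsto_upperbound[OF lim])
      show "\<forall>\<^sub>F t in at a within {..<a}. poly q t \<le> 0"
        using eventually_at_left_real[OF that]
      proof eventually_elim
        case (elim t)
        then show ?case using sgn[of t] a by (simp add: zero_le_mult_iff)
      qed
    qed simp
    consider "a = 0" | "a = M" | "0 < a" "a < M" using a by fastforce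
    then have "cone M ([:- a, 1:] * q)"
    proof cases
      case 1
      have "0 \<le> poly q t" if "t \<in> {0..M}" for t
        using sgn[OF that] right 1 \<open>M > 0\<close> that by (cases "t = 0") (auto simp: zero_le_mult_iff)
      then have "cone M q" using less.hyps[of q] deg by simp
      then show ?thesis using cone_X_mult 1 by simp
    next
      case 2
      have "0 \<le> poly (- q) t" if "t \<in> {0..M}" for t
        using sgn[OF that] left 2 \<open>M > 0\<close> that by (cases "t = M") (auto simp: zero_le_mult_iff)
      then have "cone M (- q)" using less.hyps[of "- q"] deg by simp
      then have "cone M ([:M, -1:] * - q)" by (rule cone_M_minus_X_mult)
      moreover have "[:M, -1:] * - q = [:- a, 1:] * q" using 2 by simp
      ultimately show ?thesis by simp
    next
      case 3
      then have "poly q a = 0" using left right by simp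
      then obtain r where r: "q = [:- a, 1:] * r"
        by (metis poly_eq_0_iff_dvd dvdE)
      have r0: "r \<noteq> 0" using r q0 by auto
      have "degree q = Suc (degree r)"
        using r0 unfolding r by (subst degree_mult_eq) auto
      have nn: "0 \<le> poly r t" if "t \<in> {0..M}" "t \<noteq> a" for t
      proof -
        have "(t - a) * poly q t = (t - a)\<^sup>2 * poly r t"
          by (simp add: r power2_eq_square algebra_simps)
        then show ?thesis using sgn[OF that(1)] that(2) by (simp add: zero_le_mult_iff)
      qed
      have "0 \<le> poly r a"
      proof (rule tendsto_lowerbound)
        show "((\<lambda>t. poly r t) \<longlongrightarrow> poly r a) (at_right a)" by (intro tendsto_intros)
        show "\<forall>\<^sub>F t in at_right a. 0 \<le> poly r t"
          using eventually_at_right_real[OF 3(2)]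
          by eventually_elim (use a in \<open>auto intro!: nn\<close>)
      qed simp
      then have "cone M r" using less.hyps[of r] deg \<open>degree q = _\<close> nn by force
      then show ?thesis unfolding r using cone_square_mult by (simp only: mult.assoc[symmetric])
    qed
    then show ?thesis using const[OF c] p cone_add by metis
  qed
qed

text \<open>The transfer principle behind \<open>norm_poly_op_le\<close> and
  \<open>norm_fun_calc_le_affine\<close>. For \<open>A = 0\<close> the interval degenerates, which
  \<open>cone_nonneg\<close> excludes, but there only the constant coefficient survives.\<close>

lemma poly_op_nonneg:
  assumes "\<And>t. t \<in> {0..onorm A} \<Longrightarrow> 0 \<le> poly p t"
  shows "0 \<le> x \<bullet> poly_op p A x"
proof (cases "onorm A = 0")
  case True
  then have "A y = 0" for y using onorm_eq_0[OF bounded_linear] by simp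
  moreover obtain a q where "p = pCons a q" by (cases p)
  moreover have "0 \<le> poly p 0" using assms True by simp
  ultimately show ?thesis by (simp add: poly_op_simps)
next
  case False
  then have "onorm A > 0" using onorm_pos_le[OF bounded_linear] by simp
  then have "cone (onorm A) p"
    using onorm[OF bounded_linear] assms by (rule cone_nonneg)
  then show ?thesis by (simp add: cone_def pos_def)
qed

text \<open>Positivity of \<open>c\<^sup>2 - p\<^sup>2\<close> on the interval, with
  self-adjointness turning the form of \<open>p\<^sup>2\<close> into a squared norm.\<close>

lemma norm_poly_op_le:
  assumes "0 \<le> c" "\<And>t. t \<in> {0..onorm A} \<Longrightarrow> \<bar>poly p t\<bar> \<le> c"
  shows "norm (poly_op p A x) \<le> c * norm x"
proof -
  have "0 \<le> x \<bullet> poly_op ([:c\<^sup>2:] - p * p) A x"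
  proof (rule poly_op_nonneg)
    fix t assume "t \<in> {0..onorm A}"
    then have "\<bar>poly p t\<bar>\<^sup>2 \<le> c\<^sup>2" using assms by (intro power_mono) auto
    then show "0 \<le> poly ([:c\<^sup>2:] - p * p) t" by (simp add: power2_eq_square)
  qed
  then have "(norm (poly_op p A x))\<^sup>2 \<le> (c * norm x)\<^sup>2"
    by (simp add: poly_op_simps inner_diff poly_op_self_adjoint[symmetric]
        power_mult_distrib dot_square_norm)
  then show ?thesis using assms(1) by (rule power2_le_imp_le[OF _ mult_nonneg_nonneg]) simp
qed

end

section \<open>Continuous functional calculus\<close>

text \<open>Stone-Weierstrass with tolerance \<open>1 / (n + 1)\<close>, in the sequential form that
  \<open>fun_calc\<close> refers to.\<close>

lemma uniform_limit_poly_ex: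
  fixes f :: "real \<Rightarrow> real"
  assumes "compact S" "continuous_on S f"
  shows "\<exists>p. uniform_limit S (\<lambda>n. poly (p n)) f sequentially"
proof -
  have "\<exists>p. \<forall>x\<in>S. \<bar>f x - poly p x\<bar> < inverse (real (Suc n))" for n
  proof -
    obtain g where "real_polynomial_function g"
      and g: "\<And>x. x \<in> S \<Longrightarrow> \<bar>f x - g x\<bar> < inverse (real (Suc n))"
      using Stone_Weierstrass_real_polynomial_function[OF assms, of "inverse (real (Suc n))"]
      by auto
    then obtain a N where "g = (\<lambda>x. \<Sum>i\<le>N. a i * x ^ i)"
      using real_polynomial_function_iff_sum by metis
    then have "g x = poly (\<Sum>i\<le>N. monom (a i) i) x" for x
      by (simp add: poly_sum poly_monom)
    then show ?thesis using g by metis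
  qed
  then obtain p where p: "\<And>n x. x \<in> S \<Longrightarrow> \<bar>f x - poly (p n) x\<bar> < inverse (real (Suc n))"
    by metis
  have "uniform_limit S (\<lambda>n. poly (p n)) f sequentially"
  proof (rule uniform_limitI)
    fix e :: real assume "e > 0"
    then have "\<forall>\<^sub>F n in sequentially. inverse (real (Suc n)) < e"
      using order_tendstoD(2)[OF LIMSEQ_inverse_real_of_nat] by blast
    then show "\<forall>\<^sub>F n in sequentially. \<forall>x\<in>S. dist (poly (p n) x) (f x) < e"
    proof eventually_elim
      case (elim n)
      then show ?case using p[of _ n] by (fastforce simp: dist_real_def abs_minus_commute)
    qed
  qed
  then show ?thesis by blast
qed

context positive_operator
begin

text \<open>The operator is the pointwise limit along one Weierstrass sequence. The quantitative
  bound covers every polynomial close to \<open>f\<close>, so the limit does not depend on that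
  sequence.\<close>

lemma fun_calc_bound_ex:
  assumes f: "continuous_on {0..onorm A} f"
  shows "\<exists>B. bounded_linear B \<and> (\<forall>\<epsilon>>0. \<forall>p. (\<forall>t\<in>{0..onorm A}. \<bar>poly p t - f t\<bar> \<le> \<epsilon>) \<longrightarrow>
    (\<forall>x. norm (poly_op p A x - B x) \<le> 2 * \<epsilon> * norm x))"
proof -
  obtain P where P: "uniform_limit {0..onorm A} (\<lambda>n. poly (P n)) f sequentially"
    using uniform_limit_poly_ex[OF compact_Icc f] by blast
  have close: "\<exists>N. \<forall>n\<ge>N. \<forall>t\<in>{0..onorm A}. \<bar>poly (P n) t - f t\<bar> < e" if "e > 0" for e
    using uniform_limitD[OF P that] by (simp add: eventually_sequentially dist_real_def)
  have diff: "norm (poly_op p A x - poly_op q A x) \<le> (a + b) * norm x"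
    if "\<And>t. t \<in> {0..onorm A} \<Longrightarrow> \<bar>poly p t - f t\<bar> \<le> a"
       "\<And>t. t \<in> {0..onorm A} \<Longrightarrow> \<bar>poly q t - f t\<bar> \<le> b" for p q a b x
  proof -
    have "0 \<in> {0..onorm A}" using onorm_pos_le[OF bounded_linear] by simp
    then have "0 \<le> a + b" using that[of 0] by fastforce
    then have "norm (poly_op (p - q) A x) \<le> (a + b) * norm x"
    proof (rule norm_poly_op_le)
      show "\<bar>poly (p - q) t\<bar> \<le> a + b" if "t \<in> {0..onorm A}" for t
        using \<open>\<And>t. t \<in> _ \<Longrightarrow> _ \<le> a\<close>[OF that] \<open>\<And>t. t \<in> _ \<Longrightarrow> _ \<le> b\<close>[OF that] by simp
    qed
    then show ?thesis by (simp add: poly_op_simps)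
  qed
  have "Cauchy (\<lambda>n. poly_op (P n) A x)" for x
  proof (rule metric_CauchyI)
    fix e :: real assume e: "e > 0"
    \<comment> \<open>The added 1 gives \<open>2 * d * norm x < e\<close> even for
      \<open>x = 0\<close>.\<close>
    define d where "d = e / (2 * norm x + 1)"
    have "2 * norm x + 1 > 0" using norm_ge_zero[of x] by linarith
    then have "d > 0" "d * (2 * norm x + 1) = e"
      using e by (auto simp: d_def)
    then have d: "d > 0" "(d + d) * norm x < e"
      by (auto simp: algebra_simps)
    obtain N where N: "\<And>n t. n \<ge> N \<Longrightarrow> t \<in> {0..onorm A} \<Longrightarrow> \<bar>poly (P n) t - f t\<bar> < d"
      using close[OF d(1)] by blast
    have "dist (poly_op (P m) A x) (poly_op (P n) A x) < e" if "m \<ge> N" "n \<ge> N" for m n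
      using diff[of "P m" d "P n" d x] N that d(2) by (force simp: dist_norm less_imp_le)
    then show "\<exists>N. \<forall>m\<ge>N. \<forall>n\<ge>N. dist (poly_op (P m) A x) (poly_op (P n) A x) < e" by blast
  qed
  then have "\<forall>x. \<exists>y. (\<lambda>n. poly_op (P n) A x) \<longlonglongrightarrow> y"
    using Cauchy_convergent convergent_def by blast
  then obtain B where B: "\<And>x. (\<lambda>n. poly_op (P n) A x) \<longlonglongrightarrow> B x" by metis
  \<comment> \<open>The factor 2 arises because \<open>p\<close> and, eventually, \<open>P n\<close>
    are both within \<open>e\<close> of \<open>f\<close>.\<close>
  have bound: "norm (poly_op p A x - B x) \<le> 2 * e * norm x"
    if e: "e > 0" and p: "\<forall>t\<in>{0..onorm A}. \<bar>poly p t - f t\<bar> \<le> e" for e p x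
  proof (rule Lim_norm_ubound)
    show "(\<lambda>n. poly_op p A x - poly_op (P n) A x) \<longlonglongrightarrow> poly_op p A x - B x"
      by (intro tendsto_intros B)
    obtain N where N: "\<And>n t. n \<ge> N \<Longrightarrow> t \<in> {0..onorm A} \<Longrightarrow> \<bar>poly (P n) t - f t\<bar> < e"
      using close[OF e] by blast
    have "norm (poly_op p A x - poly_op (P n) A x) \<le> 2 * e * norm x" if "n \<ge> N" for n
      using diff[of p e "P n" e x] p N[OF that] by (force simp: less_imp_le)
    then show "\<forall>\<^sub>F n in sequentially. norm (poly_op p A x - poly_op (P n) A x) \<le> 2 * e * norm x"
      by (auto simp: eventually_sequentially)
  qed simp
  have "bounded_linear B"
  proof -
    interpret Pn: linear "poly_op (P n) A" for n by (rule linear_poly_op[OF lin])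
    have add: "B (x + y) = B x + B y" for x y
      using LIMSEQ_unique[OF B[of "x + y"]] tendsto_add[OF B B] by (simp add: Pn.add)
    have scale: "B (c *\<^sub>R x) = c *\<^sub>R B x" for c x
      using LIMSEQ_unique[OF B[of "c *\<^sub>R x"]] tendsto_scaleR[OF tendsto_const B] by (simp add: Pn.scaleR)
    obtain n where n: "\<forall>t\<in>{0..onorm A}. \<bar>poly (P n) t - f t\<bar> \<le> 1"
      using close[OF zero_less_one] by (meson less_imp_le order_refl)
    have "norm (B x) \<le> norm x * (onorm (poly_op (P n) A) + 2)" for x
      using bound[OF _ n, of x] onorm[OF bounded_linear_poly_op[OF bounded_linear], of "P n" x]
        norm_triangle_ineq2[of "B x" "poly_op (P n) A x"]
      by (simp add: algebra_simps norm_minus_commute)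
    then show ?thesis by (rule bounded_linear_intro[OF add scale])
  qed
  then show ?thesis using bound by blast
qed

text \<open>\<open>fun_calc\<close> is a definite description, so its defining predicate
  \<open>G\<close> must be shown to have exactly one solution.\<close>

lemma
  assumes f: "continuous_on {0..onorm A} f"
  shows bounded_linear_fun_calc: "bounded_linear (fun_calc f A)"
    and fun_calc_limit: "uniform_limit {0..onorm A} (\<lambda>n. poly (p n)) f sequentially \<Longrightarrow>
      (\<lambda>n. poly_op (p n) A x) \<longlonglongrightarrow> fun_calc f A x"
proof -
  define G where "G B \<longleftrightarrow> bounded_linear B \<and>
     (\<forall>p. uniform_limit {0..onorm A} (\<lambda>n. poly (p n)) f sequentially
        \<longrightarrow> (\<lambda>n. onorm (\<lambda>x. poly_op (p n) A x - B x)) \<longlonglongrightarrow> 0)" for B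
  have pointwise: "(\<lambda>n. poly_op (p n) A x) \<longlonglongrightarrow> B x"
    if "G B" "uniform_limit {0..onorm A} (\<lambda>n. poly (p n)) f sequentially" for B p x
  proof -
    have "(\<lambda>n. onorm (\<lambda>x. poly_op (p n) A x - B x) * norm x) \<longlonglongrightarrow> 0"
      using that unfolding G_def by (intro tendsto_mult_left_zero) auto
    then have "(\<lambda>n. poly_op (p n) A x - B x) \<longlonglongrightarrow> 0"
    proof (rule Lim_null_comparison[rotated])
      have "bounded_linear (\<lambda>x. poly_op (p n) A x - B x)" for n
        using that(1) bounded_linear_poly_op[OF bounded_linear]
        by (auto simp: G_def intro: bounded_linear_sub)
      then show "\<forall>\<^sub>F n in sequentially. norm (poly_op (p n) A x - B x)
          \<le> onorm (\<lambda>x. poly_op (p n) A x - B x) * norm x"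
        using onorm by (intro always_eventually allI) fast
    qed
    then show ?thesis by (simp add: LIM_zero_iff)
  qed
  obtain B where B: "bounded_linear B" and
    bound: "\<And>e p x. e > 0 \<Longrightarrow> \<forall>t\<in>{0..onorm A}. \<bar>poly p t - f t\<bar> \<le> e \<Longrightarrow>
      norm (poly_op p A x - B x) \<le> 2 * e * norm x"
    using fun_calc_bound_ex[OF f] by blast
  have "G B"
    unfolding G_def
  proof (intro conjI allI impI B tendstoI)
    fix p and e :: real
    assume p: "uniform_limit {0..onorm A} (\<lambda>n. poly (p n)) f sequentially" and e: "e > 0"
    then have "\<forall>\<^sub>F n in sequentially. \<forall>t\<in>{0..onorm A}. dist (poly (p n) t) (f t) < e / 3"
      using uniform_limitD[OF p, of "e/3"] by simp
    then show "\<forall>\<^sub>F n in sequentially. dist (onorm (\<lambda>x. poly_op (p n) A x - B x)) 0 < e"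
    proof eventually_elim
      case (elim n)
      then have "onorm (\<lambda>x. poly_op (p n) A x - B x) \<le> 2 * (e / 3)"
        using e by (intro onorm_bound bound) (auto simp: dist_real_def less_imp_le)
      moreover have "0 \<le> onorm (\<lambda>x. poly_op (p n) A x - B x)"
        by (intro onorm_pos_le bounded_linear_sub bounded_linear_poly_op[OF bounded_linear] B)
      ultimately show ?case using e by simp
    qed
  qed
  moreover have "B' = B" if "G B'" for B'
  proof -
    \<comment> \<open>Uniqueness rests on the existence of an approximating sequence; without one
      the convergence clause of \<open>G\<close> would be vacuous.\<close>
    obtain P where P: "uniform_limit {0..onorm A} (\<lambda>n. poly (P n)) f sequentially"
      using uniform_limit_poly_ex[OF compact_Icc f] by blast
    show ?thesis
      using LIMSEQ_unique[OF pointwise[OF that P] pointwise[OF \<open>G B\<close> P]] by blast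
  qed
  ultimately have "G (THE B. G B)" by (rule theI)
  then have *: "G (fun_calc f A)" unfolding fun_calc_def G_def .
  then show "bounded_linear (fun_calc f A)" by (simp add: G_def)
  show "uniform_limit {0..onorm A} (\<lambda>n. poly (p n)) f sequentially \<Longrightarrow>
      (\<lambda>n. poly_op (p n) A x) \<longlonglongrightarrow> fun_calc f A x"
    by (rule pointwise[OF *])
qed

lemma fun_calc_self_adjoint:
  assumes "continuous_on {0..onorm A} f"
  shows "fun_calc f A x \<bullet> y = x \<bullet> fun_calc f A y"
proof -
  obtain P where P: "uniform_limit {0..onorm A} (\<lambda>n. poly (P n)) f sequentially"
    using uniform_limit_poly_ex[OF compact_Icc assms] by blast
  have "(\<lambda>n. poly_op (P n) A x \<bullet> y) \<longlonglongrightarrow> fun_calc f A x \<bullet> y"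
       "(\<lambda>n. x \<bullet> poly_op (P n) A y) \<longlonglongrightarrow> x \<bullet> fun_calc f A y"
    by (intro tendsto_intros fun_calc_limit assms P)+
  then show ?thesis
    unfolding poly_op_self_adjoint by (rule LIMSEQ_unique)
qed

text \<open>Squares of approximating polynomials stay below \<open>a + e + b * t\<close> eventually,
  where \<open>e\<close> absorbs the approximation error. Positivity gives the bound for them; then
  \<open>n\<close> tends to infinity and \<open>e\<close> to 0.\<close>

lemma norm_fun_calc_le_affine:
  assumes f: "continuous_on {0..onorm A} f"
    and le: "\<And>t. t \<in> {0..onorm A} \<Longrightarrow> (f t)\<^sup>2 \<le> a + b * t"
  shows "(norm (fun_calc f A x))\<^sup>2 \<le> a * (norm x)\<^sup>2 + b * (x \<bullet> A x)"
proof -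
  obtain P where P: "uniform_limit {0..onorm A} (\<lambda>n. poly (P n)) f sequentially"
    using uniform_limit_poly_ex[OF compact_Icc f] by blast
  have bdd: "bounded (f ` {0..onorm A})"
    using f by (intro compact_imp_bounded compact_continuous_image) auto
  have sq: "uniform_limit {0..onorm A} (\<lambda>n t. poly (P n) t * poly (P n) t) (\<lambda>t. f t * f t) sequentially"
    using bdd by (intro uniform_lim_mult P) auto
  have approx: "(norm (fun_calc f A x))\<^sup>2 \<le> (a + e) * (norm x)\<^sup>2 + b * (x \<bullet> A x)" if e: "e > 0" for e
  proof (rule tendsto_upperbound)
    show "(\<lambda>n. (norm (poly_op (P n) A x))\<^sup>2) \<longlonglongrightarrow> (norm (fun_calc f A x))\<^sup>2"
      by (intro tendsto_intros fun_calc_limit f P)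
    show "\<forall>\<^sub>F n in sequentially. (norm (poly_op (P n) A x))\<^sup>2 \<le> (a + e) * (norm x)\<^sup>2 + b * (x \<bullet> A x)"
      using uniform_limitD[OF sq e]
    proof eventually_elim
      case (elim n)
      have "0 \<le> x \<bullet> poly_op ([:a + e, b:] - P n * P n) A x"
      proof (rule poly_op_nonneg)
        fix t assume t: "t \<in> {0..onorm A}"
        then have "\<bar>poly (P n) t * poly (P n) t - f t * f t\<bar> < e"
          using elim by (simp add: dist_real_def)
        then show "0 \<le> poly ([:a + e, b:] - P n * P n) t"
          using le[OF t] by (simp add: power2_eq_square algebra_simps)
      qed
      then show ?case
        by (simp add: poly_op_simps A.scaleR inner_diff inner_add
            poly_op_self_adjoint[symmetric] dot_square_norm)
    qed
  qed simp
  have le': "(norm (fun_calc f A x))\<^sup>2 \<le> (a * (norm x)\<^sup>2 + b * (x \<bullet> A x)) + e * (norm x)\<^sup>2" if "e > 0" for e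
    using approx[OF that] by (simp add: algebra_simps)
  show ?thesis
  proof (rule tendsto_lowerbound)
    show "((\<lambda>e. (a * (norm x)\<^sup>2 + b * (x \<bullet> A x)) + e * (norm x)\<^sup>2) \<longlongrightarrow>
        a * (norm x)\<^sup>2 + b * (x \<bullet> A x)) (at_right 0)"
      by (auto intro!: tendsto_eq_intros)
    show "\<forall>\<^sub>F e in at_right 0. (norm (fun_calc f A x))\<^sup>2
        \<le> a * (norm x)\<^sup>2 + b * (x \<bullet> A x) + e * (norm x)\<^sup>2"
      using eventually_at_right_less[of "0::real"] by eventually_elim (rule le')
  qed simp
qed

end

section \<open>Index functions\<close>

context
  fixes f :: "real \<Rightarrow> real"
  assumes f: "index_function f"
begin

lemma index_nonneg: "0 \<le> t \<Longrightarrow> 0 \<le> f t"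
  and index_zero: "f 0 = 0"
  and index_sq_strict_mono: "strict_mono_on {0..} (\<lambda>t. (f t)\<^sup>2)"
  and Theta_strict_mono: "strict_mono_on {0..} (Theta f)"
  and index_convex: "convex_on ((\<lambda>t. (f t)\<^sup>2) ` {0..}) (the_inv_into {0..} (\<lambda>t. (f t)\<^sup>2))"
  using f by (auto simp: index_function_def)

lemma index_strict_mono:
  assumes "0 \<le> x" "x < y"
  shows "f x < f y"
proof -
  have "(f x)\<^sup>2 < (f y)\<^sup>2"
    using strict_mono_onD[OF index_sq_strict_mono, of x y] assms by simp
  then show ?thesis
    using index_nonneg[of y] assms power2_less_imp_less[of "f x" "f y"] by simp
qed

text \<open>
  The range of \<open>f\<^sup>2\<close> is an interval, so a strictly increasing extension to the whole line has open
  range and is therefore continuous.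
\<close>

lemma index_continuous: "continuous_on {0..} f"
proof -
  \<comment> \<open>The identity extends \<open>f\<^sup>2\<close> to the left; since
    \<open>f 0 = 0\<close>, the two ranges join without a gap.\<close>
  define G where "G x = (if x < 0 then x else (f x)\<^sup>2)" for x
  have mono: "G x < G y" if "x < y" for x y
  proof (cases "x < 0")
    case True
    then show ?thesis using that by (auto simp: G_def intro: less_le_trans)
  next
    case False
    then show ?thesis
      using that strict_mono_onD[OF index_sq_strict_mono, of x y] by (simp add: G_def)
  qed
  have conv: "z \<in> range G" if "G a \<le> z" "z \<le> G b" for a b z
  proof (cases "z < 0")
    case True
    then have "G z = z" by (simp add: G_def)
    then show ?thesis by (metis rangeI)
  next
    case False
    have "z \<in> (\<lambda>t. (f t)\<^sup>2) ` {0..}"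
    proof (cases "b < 0")
      case True
      then show ?thesis using that False by (simp add: G_def)
    next
      case b: False
      have "is_interval ((\<lambda>t. (f t)\<^sup>2) ` {0..})"
        using convex_on_imp_convex[OF index_convex] is_interval_convex_1 by blast
      moreover have "0 \<in> (\<lambda>t. (f t)\<^sup>2) ` {0..}" using index_zero by force
      moreover have "G b \<in> (\<lambda>t. (f t)\<^sup>2) ` {0..}" using b by (auto simp: G_def)
      ultimately show ?thesis using that(2) False unfolding is_interval_1 by (meson not_less)
    qed
    then obtain t where "t \<ge> 0" "z = (f t)\<^sup>2" by auto
    then have "z = G t" by (simp add: G_def)
    then show ?thesis by simp
  qed
  have "open (range G)"
    unfolding open_dist
  proof safe
    fix x
    define e where "e = min (G x - G (x - 1)) (G (x + 1) - G x)"
    have "e > 0" using mono[of "x - 1" x] mono[of x "x + 1"] by (simp add: e_def)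
    moreover have "y \<in> range G" if "dist y (G x) < e" for y
      using that by (intro conv[of "x - 1" y "x + 1"]) (auto simp: e_def dist_real_def)
    ultimately show "\<exists>e>0. \<forall>y. dist y (G x) < e \<longrightarrow> y \<in> range G" by blast
  qed
  then have "continuous_on UNIV G"
  proof (rule continuous_onI_mono)
    show "G x \<le> G y" if "x \<le> y" for x y
      using mono[of x y] that by (cases "x = y") auto
  qed
  then have "continuous_on {0..} (\<lambda>x. sqrt (G x))"
    by (intro continuous_on_real_sqrt) (rule continuous_on_subset, auto)
  then show ?thesis
    by (rule continuous_on_eq) (simp add: G_def index_nonneg)
qed

text \<open>A subgradient \<open>k\<close> of the convex inverse of \<open>f\<^sup>2\<close> at
  \<open>(f \<mu>)\<^sup>2\<close> gives a line below the inverse; solved for the other variable, it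
  is a line of slope \<open>1 / k\<close> above \<open>f\<^sup>2\<close>.\<close>

lemma index_supporting_line:
  assumes "0 < \<mu>"
  obtains c where "0 \<le> c" "\<And>t. 0 \<le> t \<Longrightarrow> (f t)\<^sup>2 \<le> (f \<mu>)\<^sup>2 + c * (t - \<mu>)"
proof -
  define h where "h t = (f t)\<^sup>2" for t
  define I where "I = h ` {0..}"
  define \<phi> where "\<phi> = the_inv_into {0..} h"
  have conv: "convex_on I \<phi>"
    using index_convex by (simp add: I_def \<phi>_def h_def[abs_def])
  have sm: "strict_mono_on {0..} h"
    using index_sq_strict_mono by (simp add: h_def[abs_def])
  have \<phi>: "\<phi> (h t) = t" if "0 \<le> t" for t
    using that strict_mono_on_imp_inj_on[OF sm] by (simp add: \<phi>_def the_inv_into_f_f)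
  have h0: "h 0 = 0" by (simp add: h_def index_zero)
  have hI: "h t \<in> I" if "0 \<le> t" for t using that by (simp add: I_def)
  have hpos: "0 < h \<mu>" "h \<mu> < h (2 * \<mu>)"
    using strict_mono_onD[OF sm, of 0 \<mu>] strict_mono_onD[OF sm, of \<mu> "2 * \<mu>"] assms h0 by auto
  \<comment> \<open>A subgradient is available at interior points; the values at 0 and
    \<open>2 * \<mu>\<close> leave room on both sides.\<close>
  have "h \<mu> \<in> interior I"
  proof (rule interiorI)
    show "open {0<..<h (2 * \<mu>)}" by simp
    show "h \<mu> \<in> {0<..<h (2 * \<mu>)}" using hpos by simp
    have "is_interval I"
      using convex_on_imp_convex[OF conv] is_interval_convex_1 by blast
    moreover have "0 \<in> I" "h (2 * \<mu>) \<in> I"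
      using hI[of 0] hI[of "2 * \<mu>"] assms h0 by auto
    ultimately show "{0<..<h (2 * \<mu>)} \<subseteq> I"
      by (meson mem_is_interval_1_I less_imp_le greaterThanLessThan_iff subsetI)
  qed
  then obtain k where k: "\<And>y. y \<in> I \<Longrightarrow> \<phi> (h \<mu>) + k * (y - h \<mu>) \<le> \<phi> y"
    using convex_le_Inf_differential[OF conv] by blast
  \<comment> \<open>The subgradient inequality at 0 forces \<open>k > 0\<close>, so the line can be
    inverted.\<close>
  have "\<mu> \<le> k * h \<mu>"
    using k[OF hI[of 0]] \<phi>[of 0] \<phi>[of \<mu>] assms h0 by simp
  then have kpos: "k > 0"
    using assms hpos(1) by (metis less_le_trans zero_less_mult_pos2)
  show thesis
  proof (rule that)
    show "0 \<le> 1 / k" using kpos by simp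
    show "(f t)\<^sup>2 \<le> (f \<mu>)\<^sup>2 + 1 / k * (t - \<mu>)" if "0 \<le> t" for t
      using k[OF hI[OF that]] \<phi>[OF that] \<phi>[of \<mu>] assms kpos
      by (simp add: h_def field_simps)
  qed
qed

lemma Theta_surj:
  assumes "0 \<le> y"
  obtains t where "0 \<le> t" "Theta f t = y"
proof -
  have f1: "f 1 > 0" using index_strict_mono[of 0 1] index_zero by simp
  \<comment> \<open>Chosen so that \<open>sqrt b\<close> is at least \<open>y / f 1\<close> and
    \<open>b \<ge> 1\<close>, whence \<open>f b \<ge> f 1\<close> and
    \<open>Theta f b \<ge> y\<close>.\<close>
  define b where "b = 1 + (y / f 1)\<^sup>2"
  have b: "1 \<le> b" by (simp add: b_def)
  have "y / f 1 \<le> sqrt b" by (rule real_le_rsqrt) (simp add: b_def)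
  then have "y \<le> f 1 * sqrt b" using f1 by (simp add: field_simps)
  also have "f 1 \<le> f b"
    using index_strict_mono[of 1 b] b by (cases "b = 1") auto
  then have "f 1 * sqrt b \<le> Theta f b"
    using b by (simp add: Theta_def mult_right_mono)
  finally have "y \<le> Theta f b" .
  moreover have "Theta f 0 \<le> y" using assms by (simp add: Theta_def)
  moreover have "continuous_on {0..b} (Theta f)"
    unfolding Theta_def[abs_def]
    by (intro continuous_intros continuous_on_subset[OF index_continuous]) auto
  ultimately obtain t where "0 \<le> t" "Theta f t = y"
    using IVT'[of "Theta f" 0 y b] b by auto
  then show thesis by (rule that)
qed

lemma
  assumes "0 \<le> y"
  shows Theta_inv_nonneg: "0 \<le> Theta_inv f y"
    and Theta_Theta_inv: "Theta f (Theta_inv f y) = y"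
proof -
  obtain t where "0 \<le> t" "Theta f t = y" by (rule Theta_surj[OF assms])
  then have "Theta_inv f y = t"
    using the_inv_into_f_f[OF strict_mono_on_imp_inj_on[OF Theta_strict_mono], of t]
    by (simp add: Theta_inv_def)
  then show "0 \<le> Theta_inv f y" "Theta f (Theta_inv f y) = y"
    using \<open>0 \<le> t\<close> \<open>Theta f t = y\<close> by simp_all
qed

end

section \<open>Convergence rates\<close>

lemma inner_adjoint_comp:
  fixes T :: "'a::{real_inner,complete_space} \<Rightarrow>\<^sub>L 'b::real_inner"
  shows "x \<bullet> (adjoint (blinfun_apply T) \<circ> blinfun_apply T) y = T x \<bullet> T y"
  by (simp add: inner_adjoint[OF blinfun.bounded_linear_right, symmetric])

text \<open>Everything follows from the weak identity
  \<open>x \<bullet> A y = T x \<bullet> T y\<close>: linearity by testing with all vectors, the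
  bound by testing with \<open>A x\<close>.\<close>

lemma positive_operator_adjoint_comp:
  fixes T :: "'a::{real_inner,complete_space} \<Rightarrow>\<^sub>L 'b::real_inner"
  shows "positive_operator (adjoint (blinfun_apply T) \<circ> blinfun_apply T)"
proof -
  define A where "A = adjoint (blinfun_apply T) \<circ> blinfun_apply T"
  have A: "x \<bullet> A y = T x \<bullet> T y" for x y
    unfolding A_def by (rule inner_adjoint_comp)
  have eq: "u = v" if "\<And>x. x \<bullet> u = x \<bullet> v" for u v :: 'a
    using that[of "u - v"] by (metis inner_diff_right inner_eq_zero_iff right_minus_eq)
  have "A (x + y) = A x + A y" for x y
    by (rule eq) (simp only: A inner_add_right blinfun.add_right)
  moreover have "A (c *\<^sub>R x) = c *\<^sub>R A x" for c x
    by (rule eq) (simp only: A inner_scaleR_right blinfun.scaleR_right)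
  moreover have "norm (A x) \<le> norm x * (norm T * norm T)" for x
  proof (cases "A x = 0")
    case False
    have "norm (A x) * norm (A x) = A x \<bullet> A x"
      by (simp add: dot_square_norm power2_eq_square)
    also have "\<dots> = T (A x) \<bullet> T x" by (rule A)
    also have "\<dots> \<le> norm (T (A x)) * norm (T x)" by (rule norm_cauchy_schwarz)
    also have "\<dots> \<le> (norm T * norm (A x)) * (norm T * norm x)"
      by (intro mult_mono norm_blinfun) auto
    finally have "norm (A x) * norm (A x) \<le> norm (A x) * (norm x * (norm T * norm T))"
      by (simp add: mult_ac)
    then show ?thesis using False by simp
  qed auto
  ultimately have "bounded_linear A" by (rule bounded_linear_intro)
  moreover have "A x \<bullet> y = x \<bullet> A y" for x y
    using A[of x y] A[of y x] inner_commute[of "A x" y] inner_commute[of "T x" "T y"] by simp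
  moreover have "0 \<le> x \<bullet> A x" for x by (simp only: A inner_ge_zero)
  ultimately have "positive_operator A" by (rule positive_operator.intro)
  then show ?thesis by (simp only: A_def)
qed

section \<open>The rate from the source condition\<close>

text \<open>The supporting line at \<open>\<mu>\<close> bounds the left side; as its slope is
  nonnegative, the assumption on \<open>x \<bullet> A x\<close> makes the slope terms
  cancel.\<close>

lemma (in positive_operator) index_function_interpolation:
  assumes f: "index_function f" and "0 < \<mu>" "x \<bullet> A x \<le> \<mu> * (norm x)\<^sup>2"
  shows "norm (fun_calc f A x) \<le> f \<mu> * norm x"
proof -
  obtain c where c: "0 \<le> c" "\<And>t. 0 \<le> t \<Longrightarrow> (f t)\<^sup>2 \<le> (f \<mu>)\<^sup>2 + c * (t - \<mu>)"
    using index_supporting_line[OF f \<open>0 < \<mu>\<close>] by blast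
  have cont: "continuous_on {0..onorm A} f"
    by (rule continuous_on_subset[OF index_continuous[OF f]]) auto
  have "(norm (fun_calc f A x))\<^sup>2 \<le> ((f \<mu>)\<^sup>2 - c * \<mu>) * (norm x)\<^sup>2 + c * (x \<bullet> A x)"
    using c(2) by (intro norm_fun_calc_le_affine cont) (simp add: algebra_simps)
  also have "\<dots> \<le> ((f \<mu>)\<^sup>2 - c * \<mu>) * (norm x)\<^sup>2 + c * (\<mu> * (norm x)\<^sup>2)"
    using assms(3) c(1) by (intro add_left_mono mult_left_mono)
  also have "\<dots> = (f \<mu> * norm x)\<^sup>2"
    by (simp add: algebra_simps power_mult_distrib)
  finally show ?thesis
    by (rule power2_le_imp_le) (use index_nonneg[OF f, of \<mu>] \<open>0 < \<mu>\<close> in auto)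
qed

text \<open>By contradiction: an error above the claimed bound would turn the absolute bound on
  \<open>T e\<close> into the relative bound that the interpolation inequality requires, and
  interpolation then returns the claimed bound.\<close>

lemma source_condition_rate:
  fixes T :: "'a::{real_inner,complete_space} \<Rightarrow>\<^sub>L 'b::real_inner"
  assumes f: "index_function f"
    and source: "qd - q0 = fun_calc f (adjoint (blinfun_apply T) \<circ> blinfun_apply T) s"
    and closer: "norm (q - q0) \<le> norm (qd - q0)"
    and residual: "norm (T (q - qd)) \<le> \<epsilon>" and "0 < \<epsilon>"
  shows "norm (q - qd) \<le> 2 * norm s * f (Theta_inv f (\<epsilon> / (2 * norm s)))"
proof -
  define A where "A = adjoint (blinfun_apply T) \<circ> blinfun_apply T"
  interpret positive_operator A
    unfolding A_def by (rule positive_operator_adjoint_comp)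
  have cont: "continuous_on {0..onorm A} f"
    by (rule continuous_on_subset[OF index_continuous[OF f]]) auto
  have source': "qd - q0 = fun_calc f A s" using source by (simp add: A_def)
  show ?thesis
  proof (cases "s = 0")
    case True
    then have "qd = q0"
      using source' linear_0[OF bounded_linear.linear[OF bounded_linear_fun_calc[OF cont]]] by simp
    then show ?thesis using closer True by simp
  next
    case False
    define e where "e = q - qd"
    \<comment> \<open>With this choice the claimed bound times \<open>sqrt \<mu>\<close> is exactly
      \<open>\<epsilon>\<close>.\<close>
    define \<mu> where "\<mu> = Theta_inv f (\<epsilon> / (2 * norm s))"
    have \<mu>: "0 \<le> \<mu>" "Theta f \<mu> = \<epsilon> / (2 * norm s)"
      using Theta_inv_nonneg[OF f] Theta_Theta_inv[OF f] \<open>0 < \<epsilon>\<close> by (simp_all add: \<mu>_def)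
    have "Theta f \<mu> > 0" using \<mu>(2) \<open>0 < \<epsilon>\<close> False by simp
    then have "\<mu> > 0" using \<mu>(1) by (cases "\<mu> = 0") (auto simp: Theta_def)
    have eps: "\<epsilon> = 2 * norm s * f \<mu> * sqrt \<mu>"
      using \<mu>(2) False by (simp add: Theta_def field_simps)
    have "norm e \<le> 2 * norm s * f \<mu>"
    proof (rule ccontr)
      assume "\<not> ?thesis"
      then have large: "2 * norm s * f \<mu> < norm e" by simp
      have nonneg: "0 \<le> 2 * norm s * f \<mu>"
        using index_nonneg[OF f \<mu>(1)] by simp
      have "norm (T e) \<le> norm e * sqrt \<mu>"
        using residual large \<mu>(1) mult_right_mono[of "2 * norm s * f \<mu>" "norm e" "sqrt \<mu>"]
        by (simp add: eps e_def)
      then have "(norm (T e))\<^sup>2 \<le> (norm e * sqrt \<mu>)\<^sup>2"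
        by (rule power_mono) simp
      then have "e \<bullet> A e \<le> \<mu> * (norm e)\<^sup>2"
        using \<mu>(1) unfolding A_def inner_adjoint_comp
        by (simp add: power_mult_distrib dot_square_norm mult.commute)
      then have interp: "norm (fun_calc f A e) \<le> f \<mu> * norm e"
        using f \<open>\<mu> > 0\<close> by (intro index_function_interpolation)
      have "(norm (e + (qd - q0)))\<^sup>2 \<le> (norm (qd - q0))\<^sup>2"
        using closer by (intro power_mono) (simp_all add: e_def)
      then have "norm e * norm e \<le> 2 * - (e \<bullet> (qd - q0))"
        unfolding power2_eq_square[symmetric] power2_norm_eq_inner inner_add inner_commute[of "qd - q0" e]
        by simp
      also have "\<dots> = 2 * - (fun_calc f A e \<bullet> s)"
        by (simp only: source' fun_calc_self_adjoint[OF cont])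
      also have "\<dots> \<le> 2 * (norm (fun_calc f A e) * norm s)"
        using abs_le_D2[OF Cauchy_Schwarz_ineq2] by (intro mult_left_mono) auto
      also have "\<dots> \<le> 2 * (f \<mu> * norm e * norm s)"
        by (intro mult_left_mono mult_right_mono interp) auto
      also have "\<dots> = (2 * norm s * f \<mu>) * norm e" by simp
      also have "\<dots> < norm e * norm e"
        using large nonneg by (intro mult_strict_right_mono) auto
      finally show False by simp
    qed
    then show ?thesis by (simp add: e_def \<mu>_def)
  qed
qed

section \<open>Boundedness of the iterates\<close>

text \<open>The residual at \<open>qd\<close> is a Taylor remainder plus noise. The cone condition
  bounds the remainder by \<open>F p - F qd\<close>, which is traded for the residual at
  \<open>p\<close> plus \<open>\<delta>\<close>; the factors 2 come from squaring the sum.\<close>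

lemma tangential_cone_lin_residual:
  assumes tc: "tangential_cone B F F' c" and "0 \<le> c" and "p \<in> B" "qd \<in> B"
    and noise: "norm (F qd - y) \<le> \<delta>"
  shows "lin_residual F F' y p qd \<le> 2 * c\<^sup>2 * (norm (F p - y))\<^sup>2 + 2 * (1 + c)\<^sup>2 * \<delta>\<^sup>2"
proof -
  define a where "a = c * norm (F p - y)"
  define b where "b = (1 + c) * \<delta>"
  have "norm (F p - F qd) \<le> norm (F p - y) + \<delta>"
    using norm_triangle_ineq4[of "F p - y" "F qd - y"] noise by simp
  then have "c * norm (F p - F qd) \<le> c * (norm (F p - y) + \<delta>)"
    using \<open>0 \<le> c\<close> by (rule mult_left_mono)
  moreover have "norm (F p - F qd - F' p (p - qd)) \<le> c * norm (F p - F qd)"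
    using tc assms(3,4) by (simp add: tangential_cone_def)
  moreover have "F' p (qd - p) + F p - y = (F p - F qd - F' p (p - qd)) + (F qd - y)"
    by (simp add: blinfun.diff_right)
  then have "norm (F' p (qd - p) + F p - y) \<le> norm (F p - F qd - F' p (p - qd)) + norm (F qd - y)"
    by (simp only: norm_triangle_ineq)
  ultimately have "norm (F' p (qd - p) + F p - y) \<le> a + b"
    using noise by (simp add: a_def b_def algebra_simps)
  then have "lin_residual F F' y p qd \<le> (a + b)\<^sup>2"
    unfolding lin_residual_def by (intro power_mono) auto
  also have "\<dots> \<le> 2 * a\<^sup>2 + 2 * b\<^sup>2"
    using zero_le_power2[of "a - b"] by (simp add: power2_sum power2_diff)
  finally show ?thesis by (simp add: a_def b_def power_mult_distrib)
qed

text \<open>Testing minimality with \<open>qd\<close>, the linearized residual of \<open>qd\<close>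
  and the discretization errors together stay below \<open>\<theta> * I3h\<close>, while that of the
  discrete iterate is at least this large. Only the penalty terms remain. Induction keeps the
  iterates in the ball where the cone condition holds.\<close>

lemma irgnm_run_norm_le:
  assumes tc: "tangential_cone (ball q0 \<rho>) F F' c" and "0 \<le> c" and "0 < \<tau>" and "0 \<le> \<delta>"
    and qd: "qd \<in> ball q0 \<rho>" and noise: "norm (F qd - gdata R) \<le> \<delta>"
    and run: "irgnm_run F F' Qh Fh Fh' q0 qd R ks"
    and stop: "stopping_index Fh R \<tau> \<delta> ks"
    and err1: "\<And>k. k < ks \<Longrightarrow> \<bar>I1h Fh Fh' q0 R k - I1 F F' q0 R k\<bar> \<le> \<eta>1 k"
    and err3: "\<And>k. k < ks \<Longrightarrow> \<bar>I3h Fh R k - I3 F R k\<bar> \<le> \<eta>3 k"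
    and \<eta>: "\<And>k. k < ks \<Longrightarrow>
      \<eta>1 k + 2 * c\<^sup>2 * \<eta>3 k \<le> (\<theta> - 2 * (c\<^sup>2 + (1 + c)\<^sup>2 / \<tau>\<^sup>2)) * I3h Fh R k"
    and \<theta>: "\<And>k. k < ks \<Longrightarrow> \<theta> * I3h Fh R k \<le> I2h Fh Fh' R k"
    and "k \<le> ks"
  shows "norm (q_old R k - q0) \<le> norm (qd - q0)"
  using \<open>k \<le> ks\<close>
proof (induction k)
  case 0
  then show ?case using run by (simp add: irgnm_run_def)
next
  case (Suc k)
  then have k: "k < ks" by simp
  have old: "q_old R k \<in> ball q0 \<rho>"
    using Suc qd by (simp add: dist_norm norm_minus_commute)
  have beta: "beta R k > 0" and next_iterate: "q_old R (Suc k) = q_disc R k"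
    and min: "I1 F F' q0 R k \<le> gn_functional F F' q0 (gdata R) (beta R k) (q_old R k) qd"
    using run k by (auto simp: irgnm_run_def is_arg_min_def I1_def not_less)
  \<comment> \<open>Before the stopping index the test fails, so the residual dominates the
    noise.\<close>
  have "\<tau>\<^sup>2 * \<delta>\<^sup>2 \<le> I3h Fh R k" using stop k by (force simp: stopping_index_def)
  then have \<delta>: "\<delta>\<^sup>2 \<le> I3h Fh R k / \<tau>\<^sup>2" using \<open>0 < \<tau>\<close> by (simp add: field_simps)
  have "\<theta> * I3h Fh R k + 1 / beta R k * (norm (q_disc R k - q0))\<^sup>2 \<le> I1h Fh Fh' q0 R k"
    using \<theta>[OF k] by (simp add: I1h_def I2h_def gn_functional_def)
  also have "\<dots> \<le> I1 F F' q0 R k + \<eta>1 k" using err1[OF k] by simp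
  also have "\<dots> \<le> lin_residual F F' (gdata R) (q_old R k) qd
      + 1 / beta R k * (norm (qd - q0))\<^sup>2 + \<eta>1 k"
    using min by (simp add: gn_functional_def)
  also have "lin_residual F F' (gdata R) (q_old R k) qd
      \<le> 2 * c\<^sup>2 * I3 F R k + 2 * (1 + c)\<^sup>2 * \<delta>\<^sup>2"
    unfolding I3_def by (rule tangential_cone_lin_residual[OF tc \<open>0 \<le> c\<close> old qd noise])
  also have "\<dots> \<le> 2 * c\<^sup>2 * (I3h Fh R k + \<eta>3 k) + 2 * (1 + c)\<^sup>2 * (I3h Fh R k / \<tau>\<^sup>2)"
    using err3[OF k] \<delta> by (intro add_mono mult_left_mono) auto
  also have "\<dots> + 1 / beta R k * (norm (qd - q0))\<^sup>2 + \<eta>1 k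
      \<le> \<theta> * I3h Fh R k + 1 / beta R k * (norm (qd - q0))\<^sup>2"
    using \<eta>[OF k] by (simp add: algebra_simps)
  finally have "1 / beta R k * (norm (q_disc R k - q0))\<^sup>2 \<le> 1 / beta R k * (norm (qd - q0))\<^sup>2"
    by simp
  then have "(norm (q_disc R k - q0))\<^sup>2 \<le> (norm (qd - q0))\<^sup>2"
    using beta by (simp add: field_simps)
  then show ?case
    unfolding next_iterate by (rule power2_le_imp_le) simp
qed

theorem theorem2:
  fixes D :: "'q::{real_inner,complete_space} set"
    and E :: "'q \<Rightarrow> 'v::{real_inner,complete_space} \<Rightarrow> ('w::{real_inner,complete_space} \<Rightarrow>\<^sub>L real)"
    and S :: "'q \<Rightarrow> 'v"
    and C :: "'v \<Rightarrow> 'g::{real_inner,complete_space}"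
    and F :: "'q \<Rightarrow> 'g"
    and F' :: "'q \<Rightarrow> 'q \<Rightarrow>\<^sub>L 'g"
    and Qh :: "'h \<Rightarrow> 'q set" and Vh :: "'h \<Rightarrow> 'v set" and Wh :: "'h \<Rightarrow> 'w set"
    and Sh :: "'h \<Rightarrow> 'q \<Rightarrow> 'v"
    and Fh :: "'h \<Rightarrow> 'q \<Rightarrow> 'g"
    and Fh' :: "'h \<Rightarrow> 'q \<Rightarrow> 'q \<Rightarrow>\<^sub>L 'g"
    and q0 qd s :: 'q and g :: 'g
    and \<rho> ctc \<tau> \<theta>lo \<theta>hi c1 c2 c3 :: real
    and f :: "real \<Rightarrow> real"
  assumes "pde_solution_map D E S"
    and "linearized_pde_well_posed (ball q0 \<rho>) E S"
    and "F = C \<circ> S"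
    and "\<forall>q\<in>ball q0 \<rho>. (F has_derivative blinfun_apply (F' q)) (at q)"
    and "galerkin_discretization D E Qh Vh Wh Sh"
    and "\<forall>h. Fh h = C \<circ> Sh h"
    and "\<forall>h. \<forall>q\<in>Qh h \<inter> ball q0 \<rho>.
           (Fh h has_derivative blinfun_apply (Fh' h q)) (at q within Qh h)"
    and "\<rho> > 0" and "ball q0 \<rho> \<subseteq> D"
    and "qd \<in> ball q0 \<rho>" and "F qd = g"
    and "weakly_seq_closed_at D F g"
    and "tangential_cone (ball q0 \<rho>) F F' ctc" and "0 < ctc" and "ctc < 1/4"
    and "\<tau> > 0" and "0 < \<theta>lo" and "\<theta>lo < \<theta>hi"
    and "2 * (ctc\<^sup>2 + (1 + ctc)\<^sup>2 / \<tau>\<^sup>2) < \<theta>lo"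
    and "(2 * \<theta>hi + 4 * ctc\<^sup>2) / (1 - 4 * ctc\<^sup>2) < 1"
    and "c1 > 0" and "c2 > 0" and "c3 > 0"
    and "(1 + c3) * ((2 * \<theta>hi + 4 * ctc\<^sup>2) / (1 - 4 * ctc\<^sup>2)) \<le> c2" and "c2 < 1"
    and "index_function f"
    and "qd - q0 = fun_calc f (adjoint (blinfun_apply (F' qd)) \<circ> blinfun_apply (F' qd)) s"
  shows "\<exists>\<delta>bar>0. \<exists>Cbar>0. \<forall>\<delta>. 0 < \<delta> \<and> \<delta> \<le> \<delta>bar \<longrightarrow>
    (\<forall>(R :: ('q, 'g, 'h) run) (ks :: nat) (\<eta>1 :: nat \<Rightarrow> real) \<eta>2 \<eta>3 \<eta>4 (r :: nat \<Rightarrow> real).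
       norm (g - gdata R) \<le> \<delta> \<and>
       irgnm_run F F' Qh Fh Fh' q0 qd R ks \<and>
       stopping_index Fh R \<tau> \<delta> ks \<and>
       (\<forall>k<ks. \<bar>I1h Fh Fh' q0 R k - I1 F F' q0 R k\<bar> \<le> \<eta>1 k) \<and>
       (\<forall>k<ks. \<bar>I2h Fh Fh' R k - I2 F F' R k\<bar> \<le> \<eta>2 k) \<and>
       (\<forall>k\<le>ks. \<bar>I3h Fh R k - I3 F R k\<bar> \<le> \<eta>3 k) \<and>
       (\<forall>k<ks. \<bar>I4h Fh R k - I4 F R k\<bar> \<le> \<eta>4 k) \<and>
       (\<forall>k<ks. \<eta>1 k + 2 * ctc\<^sup>2 * \<eta>3 k \<le> (\<theta>lo - 2 * (ctc\<^sup>2 + (1 + ctc)\<^sup>2 / \<tau>\<^sup>2)) * I3h Fh R k) \<and>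
       (\<forall>k\<le>ks. \<eta>3 k \<le> c1 * I3h Fh R k) \<and>
       \<eta>2 \<longlonglongrightarrow> 0 \<and> \<eta>3 \<longlonglongrightarrow> 0 \<and> \<eta>4 \<longlonglongrightarrow> 0 \<and>
       (\<forall>k<ks. I3h Fh R (Suc k) \<le> (1 + c3) * I4h Fh R k + r (Suc k)) \<and> r \<longlonglongrightarrow> 0 \<and>
       (\<forall>k<ks. \<theta>lo * I3h Fh R k \<le> I2h Fh Fh' R k \<and> I2h Fh Fh' R k \<le> \<theta>hi * I3h Fh R k)
       \<longrightarrow>
         (norm (q_disc R ks - qd))\<^sup>2
           \<le> Cbar\<^sup>2 * \<delta>\<^sup>2 / Theta_inv f (Cbar / (2 * norm s) * \<delta>) \<and>
         Cbar\<^sup>2 * \<delta>\<^sup>2 / Theta_inv f (Cbar / (2 * norm s) * \<delta>)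
           = 4 * (norm s)\<^sup>2 * (f (Theta_inv f (Cbar / (2 * norm s) * \<delta>)))\<^sup>2)"
proof -
  \<comment> \<open>The constant \<open>Cbar\<close>: \<open>1 + ctc\<close> comes from the cone
    condition at \<open>qd\<close>, the summand 1 from the noise, and
    \<open>\<tau> * sqrt (1 + c1)\<close> from the stopping test after passing from
    \<open>I3h\<close> to \<open>I3\<close>.\<close>
  define K where "K = (1 + ctc) * (1 + \<tau> * sqrt (1 + c1))"
  have K: "K > 0"
    using assms(14,16,21) by (auto simp: K_def intro!: mult_pos_pos add_pos_nonneg)
  note index = \<open>index_function f\<close> and tc = \<open>tangential_cone (ball q0 \<rho>) F F' ctc\<close>
  have closed_form: "K\<^sup>2 * \<delta>\<^sup>2 / Theta_inv f (K / (2 * norm s) * \<delta>)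
      = 4 * (norm s)\<^sup>2 * (f (Theta_inv f (K / (2 * norm s) * \<delta>)))\<^sup>2" if "\<delta> > 0" for \<delta>
  proof -
    define y where "y = K / (2 * norm s) * \<delta>"
    define \<mu> where "\<mu> = Theta_inv f y"
    have "y \<ge> 0" using K that by (simp add: y_def)
    then have \<mu>: "0 \<le> \<mu>" "f \<mu> * sqrt \<mu> = y"
      using Theta_inv_nonneg[OF index] Theta_Theta_inv[OF index] by (simp_all add: \<mu>_def Theta_def)
    have "K\<^sup>2 * \<delta>\<^sup>2 / \<mu> = 4 * (norm s)\<^sup>2 * (f \<mu>)\<^sup>2"
    proof (cases "s = 0")
      case True
      \<comment> \<open>Division by zero gives 0, so \<open>y\<close> and \<open>\<mu>\<close>
        vanish and both sides are 0.\<close>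
      then have "f \<mu> * sqrt \<mu> = 0" using \<mu>(2) by (simp add: y_def)
      then have "\<mu> = 0"
        using \<mu>(1) index_strict_mono[OF index, of 0 \<mu>] index_zero[OF index] by fastforce
      then show ?thesis using True by simp
    next
      case False
      then have K\<delta>: "K * \<delta> = 2 * norm s * (f \<mu> * sqrt \<mu>)" by (simp add: \<mu>(2) y_def)
      moreover have "K * \<delta> > 0" using K that by simp
      ultimately have "\<mu> \<noteq> 0" by auto
      moreover have "K\<^sup>2 * \<delta>\<^sup>2 = 4 * (norm s)\<^sup>2 * (f \<mu>)\<^sup>2 * \<mu>"
        using \<mu>(1) by (simp add: power_mult_distrib K\<delta> flip: power_mult_distrib[of K \<delta>])
      ultimately show ?thesis by simp
    qed
    then show ?thesis by (simp add: \<mu>_def y_def)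
  qed
  have rate: "(norm (q_disc R ks - qd))\<^sup>2
      \<le> 4 * (norm s)\<^sup>2 * (f (Theta_inv f (K / (2 * norm s) * \<delta>)))\<^sup>2"
    if "\<delta> > 0" and noise: "norm (g - gdata R) \<le> \<delta>"
      and run: "irgnm_run F F' Qh Fh Fh' q0 qd R ks"
      and stop: "stopping_index Fh R \<tau> \<delta> ks"
      and err1: "\<And>k. k < ks \<Longrightarrow> \<bar>I1h Fh Fh' q0 R k - I1 F F' q0 R k\<bar> \<le> \<eta>1 k"
      and err3: "\<And>k. k \<le> ks \<Longrightarrow> \<bar>I3h Fh R k - I3 F R k\<bar> \<le> \<eta>3 k"
      and \<eta>: "\<And>k. k < ks \<Longrightarrow>
        \<eta>1 k + 2 * ctc\<^sup>2 * \<eta>3 k \<le> (\<theta>lo - 2 * (ctc\<^sup>2 + (1 + ctc)\<^sup>2 / \<tau>\<^sup>2)) * I3h Fh R k"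
      and \<eta>3: "\<And>k. k \<le> ks \<Longrightarrow> \<eta>3 k \<le> c1 * I3h Fh R k"
      and \<theta>: "\<And>k. k < ks \<Longrightarrow> \<theta>lo * I3h Fh R k \<le> I2h Fh Fh' R k"
    for \<delta> ks \<eta>1 \<eta>3 and R :: "('q, 'g, 'h) run"
  proof -
    define q where "q = q_disc R ks"
    \<comment> \<open>The returned iterate is the one examined by the stopping test, so the test
      controls its residual.\<close>
    have q: "q = q_old R ks" using run by (simp add: q_def irgnm_run_def)
    have noise': "norm (F qd - gdata R) \<le> \<delta>" using noise \<open>F qd = g\<close> by simp
    have closer: "norm (q - q0) \<le> norm (qd - q0)"
      unfolding q
      by (rule irgnm_run_norm_le[OF tc _ \<open>\<tau> > 0\<close> _ \<open>qd \<in> _\<close> noise' run stop err1 err3 \<eta> \<theta>])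
        (use \<open>\<delta> > 0\<close> \<open>0 < ctc\<close> in auto)
    then have ball: "q \<in> ball q0 \<rho>"
      using \<open>qd \<in> ball q0 \<rho>\<close> by (simp add: dist_norm norm_minus_commute)
    have "(norm (F q - gdata R))\<^sup>2 \<le> (1 + c1) * I3h Fh R ks"
      using err3[of ks] \<eta>3[of ks] by (simp add: I3_def q algebra_simps)
    also have "\<dots> \<le> (1 + c1) * (\<tau>\<^sup>2 * \<delta>\<^sup>2)"
      using stop \<open>c1 > 0\<close> by (simp add: stopping_index_def)
    also have "\<dots> = (\<tau> * sqrt (1 + c1) * \<delta>)\<^sup>2"
      using \<open>c1 > 0\<close> by (simp add: power_mult_distrib)
    finally have "norm (F q - gdata R) \<le> \<tau> * sqrt (1 + c1) * \<delta>"
      by (rule power2_le_imp_le) (use \<open>\<tau> > 0\<close> \<open>\<delta> > 0\<close> \<open>c1 > 0\<close> in auto)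
    then have data: "norm (F qd - F q) \<le> (1 + \<tau> * sqrt (1 + c1)) * \<delta>"
      using noise' norm_triangle_ineq4[of "F qd - gdata R" "F q - gdata R"]
      by (simp add: algebra_simps)
    \<comment> \<open>Linearizing at \<open>qd\<close> rather than at \<open>q\<close> brings in the
      operator of the source condition.\<close>
    have "norm (F' qd (q - qd)) = norm ((F qd - F q - F' qd (qd - q)) - (F qd - F q))"
      by (simp add: blinfun.diff_right)
    also have "\<dots> \<le> norm (F qd - F q - F' qd (qd - q)) + norm (F qd - F q)"
      by (rule norm_triangle_ineq4)
    also have "norm (F qd - F q - F' qd (qd - q)) \<le> ctc * norm (F qd - F q)"
      using tc ball \<open>qd \<in> _\<close> by (simp add: tangential_cone_def)
    also have "\<dots> + norm (F qd - F q) = (1 + ctc) * norm (F qd - F q)"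
      by (simp add: algebra_simps)
    also have "\<dots> \<le> (1 + ctc) * ((1 + \<tau> * sqrt (1 + c1)) * \<delta>)"
      using \<open>0 < ctc\<close> by (intro mult_left_mono data) auto
    finally have "norm (F' qd (q - qd)) \<le> K * \<delta>" by (simp add: K_def)
    then have "norm (q - qd) \<le> 2 * norm s * f (Theta_inv f (K * \<delta> / (2 * norm s)))"
      using K \<open>\<delta> > 0\<close> assms(27) by (intro source_condition_rate[OF index _ closer]) auto
    then have "(norm (q - qd))\<^sup>2 \<le> (2 * norm s * f (Theta_inv f (K * \<delta> / (2 * norm s))))\<^sup>2"
      by (rule power_mono) simp
    then show ?thesis by (simp add: power_mult_distrib q_def)
  qed
  show ?thesis
  \<comment> \<open>The estimate holds for every positive \<open>\<delta>\<close>, so 1 is an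
    arbitrary choice of the threshold.\<close>
  proof (rule exI[of _ 1], intro conjI zero_less_one exI[of _ K] allI impI K, goal_cases)
    case (1 \<delta> R ks \<eta>1 \<eta>2 \<eta>3 \<eta>4 r)
    then show ?case using rate[of \<delta> R ks \<eta>1 \<eta>3] closed_form[of \<delta>] by simp
  next
    case (2 \<delta> R ks \<eta>1 \<eta>2 \<eta>3 \<eta>4 r)
    then show ?case using closed_form[of \<delta>] by simp
  qed
qed

end
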